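(* Let $X$ and $Y$ be metric spaces equipped with nets $(X_0,i_X,e_X)$ and $(Y_0,i_Y,e_Y)$. If $X$ and $Y$ are symmetric geodesic coarsely convex spaces, then the free product $(X*Y,d_* )$ (formed with respect to these nets) is a symmetric geodesic coarsely convex space.
   Context: **Symmetric geodesic coarsely convex spaces.** A geodesic segment in a metric space $(X,d_X)$ is a map $\gamma:[0,a]\to X$ ($a\ge 0$) with $d_X(\gamma(t),\gamma(t'))=|t-t'|$ for all $t,t'\in[0,a]$; put $\gamma^{-1}(t):=\gamma(a-t)$. $X$ is a symmetric geodesic coarsely convex space if there are constants $E\ge 1$, $C\ge 0$ and a family $\mathcal{L}$ of geodesic segments such that: (i) for all $u,v\in X$ there is $\gamma\in\mathcal{L}$, $\gamma:[0,a]\to X$, with $\gamma(0)=u$, $\gamma(a)=v$; (ii) for all $\gamma,\eta\in\mathcal{L}$, $\gamma:[0,a]\to X$, $\eta:[0,b]\to X$, with $\gamma(0)=\eta(0)$, and all $t\in[0,a]$, $s\in[0,b]$, $c\in[0,1]$, one has $d_X(\gamma(ct),\eta(cs))\le cE\,d_X(\gamma(t),\eta(s))+C$; (iii) $\gamma^{-1}\in\mathcal{L}$ for every $\gamma\in\mathcal{L}$. **Nets.** A net of a metric space $X$ is a triple $(X_0,i_X,e_X)$ where $X_0$ is a set, $i_X:X_0\to X$ is a map (the index map, not necessarily injective) such that $i_X^{-1}(K)$ is finite for every compact $K\subset X$, and $e_X\in i_X(X_0)$ is a base point. Write $\overline{x_0}:=i_X(x_0)$. **Free product.** Let $(X,d_X)$,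 $(Y,d_Y)$ be metric spaces with nets $(X_0,i_X,e_X)$, $(Y_0,i_Y,e_Y)$. Choose $\epsilon_X\in X_0$, $\epsilon_Y\in Y_0$ with $\overline{\epsilon_X}=e_X$, $\overline{\epsilon_Y}=e_Y$, and let $X_0^*=X_0\setminus\{\epsilon_X\}$, $Y_0^*=Y_0\setminus\{\epsilon_Y\}$. A normal word is a finite sequence $w_0w_1\cdots w_n$ ($n\ge 0$) of elements of $X_0^*\sqcup Y_0^*$ whose letters alternate between $X_0^*$ and $Y_0^*$. Let $W$ be the set of normal words together with the empty word $\epsilon$; let $W_X$ (resp. $W_Y$) be the set consisting of $\epsilon$ and the normal words whose last letter is not in $X_0^*$ (resp. not in $Y_0^*$). The free product $X*Y$ is the quotient of $$(W_X\times X)\sqcup(W_Y\times Y)\sqcup(W_X\times X_0^*\times[0,1])\sqcup(W_Y\times Y_0^*\times[0,1])\sqcup(\{\epsilon\}\times[0,1])$$ by the equivalence relation generated by: $(\epsilon,e_X)\sim(\epsilon,0)$, $(\epsilon,e_Y)\sim(\epsilon,1)$; for $\omega\in W_X$, $x_0\in X_0^*$: $(\omega,\overline{x_0})\sim(\omega,x_0,0)$ and $(\omega x_0,e_Y)\sim(\omega,x_0,1)$; for $\tau\in W_Y$, $y_0\in Y_0^*$: $(\tau,\overline{y_0})\sim(\tau,y_0,0)$ and $(\tau y_0,e_X)\sim(\tau,y_0,1)$. The images of $\{\omega\}\times X$ ($\omega\in W_X$) and $\{\tau\}\times Y$ ($\tau\in W_Y$) are called sheets; the images of the copies of $[0,1]$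 are called edges. **Metric $d_*$.** For $z\in X$ put $\|z\|=d_X(e_X,z)$, for $z\in Y$ put $\|z\|=d_Y(e_Y,z)$. For a normal word $\sigma=s_0\cdots s_n$ put $D(\sigma)=\sum_{i=1}^n\|\overline{s_i}\|+n+1$. For points $p=(\omega,u)$, $q=(\tau,v)$ in sheets, $d_*$ is symmetric and given by: (I) if $\omega=\tau$: $d_*(p,q)=d_X(u,v)$ if $u,v\in X$, $d_*(p,q)=d_Y(u,v)$ if $u,v\in Y$, and (possible only for $\omega=\tau=\epsilon$) $d_*(p,q)=\|u\|+\|v\|+1$ if one of $u,v$ lies in $X$ and the other in $Y$; (II) if $\tau=\omega\tau'$ with $\tau'\neq\epsilon$ having initial letter $z$: $d_*(p,q)=d_*((\omega,u),(\omega,\overline{z}))+D(\tau')+\|v\|$; (III) if neither word is a prefix of the other, with maximal common prefix $\rho$, $\omega=\rho\omega'$, $\tau=\rho\tau'$, and initial letters $z_0$ of $\omega'$ and $w_0$ of $\tau'$: $d_*(p,q)=d_*((\rho,\overline{z_0}),(\rho,\overline{w_0}))+D(\omega')+D(\tau')+\|u\|+\|v\|$. The metric is extended to edges so that each edge is isometric to $[0,1]$, and for a point $p$ at parameter $t$ of an edge with endpoints $p^-$ ($t=0$), $p^+$ ($t=1$) and $q$ not on that edge, $d_*(p,q)=\min\{t+d_*(p^-,q),\,1-t+d_*(p^+,q)\}$. *)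

theory Defs
  imports "HOL-Analysis.Analysis" "HOL-Library.Sublist"
begin

section \<open>Symmetric geodesic coarsely convex spaces\<close>

text \<open>A map \<open>\<gamma> : [0,a] \<rightarrow> M\<close> is encoded as the pair \<open>(a, \<gamma>)\<close> with \<open>\<gamma>\<close> extensional
  (\<open>undefined\<close> outside \<open>[0,a]\<close>), so that equality of pairs is equality of maps.\<close>

definition geodesic_segment :: "'a set \<Rightarrow> ('a \<Rightarrow> 'a \<Rightarrow> real) \<Rightarrow> real \<times> (real \<Rightarrow> 'a) \<Rightarrow> bool" where
  "geodesic_segment M d = (\<lambda>(a, \<gamma>). 0 \<le> a \<and> \<gamma> \<in> {0..a} \<rightarrow>\<^sub>E M \<and>
     (\<forall>t\<in>{0..a}. \<forall>t'\<in>{0..a}. d (\<gamma> t) (\<gamma> t') = \<bar>t - t'\<bar>))"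

definition reverse_segment :: "real \<times> (real \<Rightarrow> 'a) \<Rightarrow> real \<times> (real \<Rightarrow> 'a)" where
  "reverse_segment = (\<lambda>(a, \<gamma>). (a, \<lambda>t\<in>{0..a}. \<gamma> (a - t)))"

definition symmetric_geodesic_coarsely_convex :: "'a set \<Rightarrow> ('a \<Rightarrow> 'a \<Rightarrow> real) \<Rightarrow> bool" where
  "symmetric_geodesic_coarsely_convex M d \<longleftrightarrow>
     Metric_space M d \<and>
     (\<exists>E C. \<exists>L :: (real \<times> (real \<Rightarrow> 'a)) set.
        1 \<le> E \<and> 0 \<le> C \<and> (\<forall>g\<in>L. geodesic_segment M d g) \<and>
        (\<forall>u\<in>M. \<forall>v\<in>M. \<exists>(a, \<gamma>)\<in>L. \<gamma> 0 = u \<and> \<gamma> a = v) \<and>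
        (\<forall>(a, \<gamma>)\<in>L. \<forall>(b, \<eta>)\<in>L. \<gamma> 0 = \<eta> 0 \<longrightarrow>
           (\<forall>t\<in>{0..a}. \<forall>s\<in>{0..b}. \<forall>c\<in>{0..1}.
              d (\<gamma> (c * t)) (\<eta> (c * s)) \<le> c * E * d (\<gamma> t) (\<eta> s) + C)) \<and>
        (\<forall>g\<in>L. reverse_segment g \<in> L))"


section \<open>Nets\<close>

definition net :: "'a set \<Rightarrow> ('a \<Rightarrow> 'a \<Rightarrow> real) \<Rightarrow> 'i set \<Rightarrow> ('i \<Rightarrow> 'a) \<Rightarrow> 'a \<Rightarrow> bool" where
  "net M d I i e \<longleftrightarrow>
     i \<in> I \<rightarrow> M \<and>
     (\<forall>K. compactin (Metric_space.mtopology M d) K \<longrightarrow> finite {x \<in> I. i x \<in> K}) \<and>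
     e \<in> i ` I"


section \<open>The free product\<close>

text \<open>Letters from the two index sets are tagged by \<^const>\<open>Inl\<close> and \<^const>\<open>Inr\<close>, as are the points
  of the two spaces. A pair \<open>(\<omega>, Inl x)\<close> stands for the point \<open>x\<close> of the copy \<open>{\<omega>} \<times> X\<close>,
  and \<open>(\<omega>, Inr y)\<close> for the point \<open>y\<close> of \<open>{\<omega>} \<times> Y\<close>. The edge \<open>Edge \<omega> z\<close> is the copy of
  \<open>[0,1]\<close> indexed by \<open>(\<omega>, z)\<close>; \<open>Base_edge\<close> is \<open>{\<epsilon>} \<times> [0,1]\<close>.\<close>

type_synonym ('i, 'j) word = "('i + 'j) list"

datatype ('i, 'j) edge = Base_edge | Edge "('i, 'j) word" "'i + 'j"

datatype ('a, 'b, 'i, 'j) pre_point =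
    On_sheet "('i, 'j) word \<times> ('a + 'b)"
  | On_edge "('i, 'j) edge" real

locale free_product =
  fixes X :: "'a set" and dX :: "'a \<Rightarrow> 'a \<Rightarrow> real"
    and X0 :: "'i set" and iX :: "'i \<Rightarrow> 'a" and eX :: 'a and epsX :: 'i
    and Y :: "'b set" and dY :: "'b \<Rightarrow> 'b \<Rightarrow> real"
    and Y0 :: "'j set" and iY :: "'j \<Rightarrow> 'b" and eY :: 'b and epsY :: 'j
begin

definition normal_words :: "('i, 'j) word set" where
  "normal_words = {w. set w \<subseteq> (X0 - {epsX}) <+> (Y0 - {epsY}) \<and>
                      successively (\<lambda>r s. isl r \<noteq> isl s) w}"
  \<comment> \<open>includes the empty word\<close>

definition words_X :: "('i, 'j) word set" where
  "words_X = {w \<in> normal_words. w = [] \<or> \<not> isl (last w)}"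

definition words_Y :: "('i, 'j) word set" where
  "words_Y = {w \<in> normal_words. w = [] \<or> isl (last w)}"

definition sheet_points :: "(('i, 'j) word \<times> ('a + 'b)) set" where
  "sheet_points = words_X \<times> Inl ` X \<union> words_Y \<times> Inr ` Y"

definition edges :: "('i, 'j) edge set" where
  "edges = {Base_edge} \<union> {Edge w (Inl x) |w x. w \<in> words_X \<and> x \<in> X0 - {epsX}}
                       \<union> {Edge w (Inr y) |w y. w \<in> words_Y \<and> y \<in> Y0 - {epsY}}"

definition pre_points :: "('a, 'b, 'i, 'j) pre_point set" where
  "pre_points = On_sheet ` sheet_points \<union> {On_edge e t |e t. e \<in> edges \<and> t \<in> {0..1}}"

abbreviation index :: "'i + 'j \<Rightarrow> 'a + 'b" where
  "index \<equiv> map_sum iX iY"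

primrec edge_start :: "('i, 'j) edge \<Rightarrow> ('i, 'j) word \<times> ('a + 'b)" where
  "edge_start Base_edge = ([], Inl eX)"
| "edge_start (Edge w z) = (w, index z)"

primrec edge_end :: "('i, 'j) edge \<Rightarrow> ('i, 'j) word \<times> ('a + 'b)" where
  "edge_end Base_edge = ([], Inr eY)"
| "edge_end (Edge w z) = (w @ [z], if isl z then Inr eY else Inl eX)"

definition glue :: "('a, 'b, 'i, 'j) pre_point rel" where
  "glue = {(On_sheet (edge_start e), On_edge e 0) |e. e \<in> edges} \<union>
          {(On_sheet (edge_end e), On_edge e 1) |e. e \<in> edges}"

definition points :: "('a, 'b, 'i, 'j) pre_point set set" where
  "points = pre_points // (glue \<union> glue\<inverse>)\<^sup>*"

fun nrm :: "'a + 'b \<Rightarrow> real" where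
  "nrm (Inl x) = dX eX x"
| "nrm (Inr y) = dY eY y"

text \<open>For \<open>\<sigma> = s\<^sub>0 \<dots> s\<^sub>n\<close> the first letter does not contribute to the sum, and the
  length of \<open>\<sigma>\<close> is \<open>n + 1\<close>.\<close>

definition word_length :: "('i, 'j) word \<Rightarrow> real" where
  "word_length \<sigma> = (\<Sum>i = 1..<length \<sigma>. nrm (index (\<sigma> ! i))) + real (length \<sigma>)"

fun dist_same_word :: "'a + 'b \<Rightarrow> 'a + 'b \<Rightarrow> real" where
  "dist_same_word (Inl x) (Inl x') = dX x x'"
| "dist_same_word (Inr y) (Inr y') = dY y y'"
| "dist_same_word u v = nrm u + nrm v + 1"

text \<open>A path between different sheets leaves the sheet of the maximal common prefix \<open>\<rho>\<close> through
  the edges determined by the letters following \<open>\<rho>\<close>. For \<open>\<rho> = []\<close> these letters, and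
  the points \<open>u\<close>, \<open>v\<close>, may belong to different factors, which is why
  \<^const>\<open>dist_same_word\<close> also covers mixed arguments.\<close>

definition dist_sheets :: "('i, 'j) word \<times> ('a + 'b) \<Rightarrow> ('i, 'j) word \<times> ('a + 'b) \<Rightarrow> real" where
  "dist_sheets = (\<lambda>(\<omega>, u) (\<tau>, v).
     let \<rho> = longest_common_prefix \<omega> \<tau>;
         \<omega>' = drop (length \<rho>) \<omega>;
         \<tau>' = drop (length \<rho>) \<tau>
     in if \<omega>' = [] \<and> \<tau>' = [] then dist_same_word u v
        else if \<omega>' = [] then dist_same_word u (index (hd \<tau>')) + word_length \<tau>' + nrm v
        else if \<tau>' = [] then dist_same_word v (index (hd \<omega>')) + word_length \<omega>' + nrm u
        else dist_same_word (index (hd \<omega>')) (index (hd \<tau>'))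
               + word_length \<omega>' + word_length \<tau>' + nrm u + nrm v)"

definition dist_edge_sheet ::
    "('i, 'j) edge \<Rightarrow> real \<Rightarrow> ('i, 'j) word \<times> ('a + 'b) \<Rightarrow> real" where
  "dist_edge_sheet e t q =
     min (t + dist_sheets (edge_start e) q) (1 - t + dist_sheets (edge_end e) q)"

fun pre_dist ::
    "('a, 'b, 'i, 'j) pre_point \<Rightarrow> ('a, 'b, 'i, 'j) pre_point \<Rightarrow> real" where
  "pre_dist (On_sheet p) (On_sheet q) = dist_sheets p q"
| "pre_dist (On_edge e t) (On_sheet q) = dist_edge_sheet e t q"
| "pre_dist (On_sheet p) (On_edge e t) = dist_edge_sheet e t p"
| "pre_dist (On_edge e t) (On_edge e' t') =
     (if e = e' then \<bar>t - t'\<bar>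
      else min (t + dist_edge_sheet e' t' (edge_start e))
               (1 - t + dist_edge_sheet e' t' (edge_end e)))"

text \<open>When \<open>X\<close> and \<open>Y\<close> are metric spaces with nets, \<^const>\<open>pre_dist\<close> is compatible with the
  gluing, so the image below is a singleton. The value \<open>0\<close> outside the free product is needed
  because \<^locale>\<open>Metric_space\<close> requires symmetry and nonnegativity on the whole type.\<close>

definition dist_star ::
    "('a, 'b, 'i, 'j) pre_point set \<Rightarrow> ('a, 'b, 'i, 'j) pre_point set \<Rightarrow> real" where
  "dist_star P Q =
     (if P \<in> points \<and> Q \<in> points then the_elem ((\<lambda>(p, q). pre_dist p q) ` (P \<times> Q)) else 0)"

end

end

theory Submission
  imports Defs
begin

text \<open>The free product is a tree of pieces: sheets and edges, each new piece meeting the earlier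
  ones in a single point. Choose symmetric geodesics in every piece and concatenate them. Two
  geodesics with a common start then agree up to the piece in which they separate, satisfy the
  convexity inequality inside that piece, and continue through different branches, where distances
  just add up. This tripod shape is inherited, with unchanged constants, when pieces are attached
  at points, hence by the union of all stages; on the other hand it implies coarse convexity with
  \<open>E + 1\<close> in place of \<open>E\<close>. The triangle inequality is inherited in the same way.\<close>

text \<open>The estimate that turns tripods into coarse convexity replaces \<open>E\<close> by
  \<open>E + 1\<close>. Applied at every attachment it would let the constants grow without bound,
  since the free product needs infinitely many attachments. A tripod therefore keeps the inequality
  confined to the piece where two geodesics separate, and the loss occurs once, after the union has
  been formed. The additional 1 pays for sliding along one geodesic: the parameters
  \<open>c * t\<close> and \<open>c * s\<close> usually lie at different fractions of the separating
  piece, while the inequality known there compares equal fractions. Concatenation needs one definite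
  geodesic for each pair of points, whereas the given families may contain many. Reversal symmetry
  of the choice is more than condition (iii): leaving a branch runs a chosen geodesic backwards, and
  this must again be the chosen geodesic from its other end, or paths leaving the branch could not
  be compared with paths staying in it.\<close>

section \<open>Tripods\<close>

text \<open>\<open>r\<close> is the length of the common part, \<open>l\<close> and \<open>m\<close>
  are the lengths run inside the separating piece, and \<open>t'\<close> and \<open>s'\<close> are
  the tails. The five numbers may depend on \<open>t\<close> and \<open>s\<close>: short initial
  parts of the same two paths can have a different shape.\<close>

definition tripod ::
    "('z \<Rightarrow> 'z \<Rightarrow> real) \<Rightarrow> real \<Rightarrow> real \<Rightarrow> (real \<Rightarrow> 'z) \<Rightarrow> real \<Rightarrow> (real \<Rightarrow> 'z) \<Rightarrow> real \<Rightarrow> bool" where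
  "tripod d E C \<gamma> t \<eta> s \<longleftrightarrow> (\<exists>r l m t' s'. 0 \<le> r \<and> 0 \<le> l \<and> 0 \<le> m \<and> 0 \<le> t' \<and> 0 \<le> s' \<and>
     t = r + l + t' \<and> s = r + m + s' \<and> (\<forall>u. 0 \<le> u \<longrightarrow> u \<le> r \<longrightarrow> \<gamma> u = \<eta> u) \<and>
     (\<forall>c. 0 \<le> c \<longrightarrow> c \<le> 1 \<longrightarrow>
       d (\<gamma> (r + c * l)) (\<eta> (r + c * m)) \<le> c * E * d (\<gamma> (r + l)) (\<eta> (r + m)) + C) \<and>
     t' + s' + d (\<gamma> (r + l)) (\<eta> (r + m)) \<le> d (\<gamma> t) (\<eta> s))"

lemma tripodE:
  assumes "tripod d E C \<gamma> t \<eta> s"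
  obtains r l m t' s' where "0 \<le> r" "0 \<le> l" "0 \<le> m" "0 \<le> t'" "0 \<le> s'"
    "t = r + l + t'" "s = r + m + s'" "\<And>u. 0 \<le> u \<Longrightarrow> u \<le> r \<Longrightarrow> \<gamma> u = \<eta> u"
    "\<And>c. 0 \<le> c \<Longrightarrow> c \<le> 1 \<Longrightarrow>
       d (\<gamma> (r + c * l)) (\<eta> (r + c * m)) \<le> c * E * d (\<gamma> (r + l)) (\<eta> (r + m)) + C"
    "t' + s' + d (\<gamma> (r + l)) (\<eta> (r + m)) \<le> d (\<gamma> t) (\<eta> s)"
  using assms unfolding tripod_def by blast

lemma tripodI:
  assumes "0 \<le> r" "0 \<le> l" "0 \<le> m" "0 \<le> t'" "0 \<le> s'"
    "t = r + l + t'" "s = r + m + s'" "\<And>u. 0 \<le> u \<Longrightarrow> u \<le> r \<Longrightarrow> \<gamma> u = \<eta> u"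
    "\<And>c. 0 \<le> c \<Longrightarrow> c \<le> 1 \<Longrightarrow>
       d (\<gamma> (r + c * l)) (\<eta> (r + c * m)) \<le> c * E * d (\<gamma> (r + l)) (\<eta> (r + m)) + C"
    "t' + s' + d (\<gamma> (r + l)) (\<eta> (r + m)) \<le> d (\<gamma> t) (\<eta> s)"
  shows "tripod d E C \<gamma> t \<eta> s"
  unfolding tripod_def
  by (rule exI[of _ r], rule exI[of _ l], rule exI[of _ m], rule exI[of _ t'], rule exI[of _ s'],
      intro conjI allI impI; rule assms; assumption)

lemma tripod_sym:
  assumes "\<And>x y. d x y = d y x" and "tripod d E C \<gamma> t \<eta> s"
  shows "tripod d E C \<eta> s \<gamma> t"
  using assms(2)
proof (rule tripodE)
  fix r l m t' s'
  assume *: "0 \<le> r" "0 \<le> l" "0 \<le> m" "0 \<le> t'" "0 \<le> s'"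
    "t = r + l + t'" "s = r + m + s'" "\<And>u. 0 \<le> u \<Longrightarrow> u \<le> r \<Longrightarrow> \<gamma> u = \<eta> u"
    "\<And>c. 0 \<le> c \<Longrightarrow> c \<le> 1 \<Longrightarrow>
       d (\<gamma> (r + c * l)) (\<eta> (r + c * m)) \<le> c * E * d (\<gamma> (r + l)) (\<eta> (r + m)) + C"
    "t' + s' + d (\<gamma> (r + l)) (\<eta> (r + m)) \<le> d (\<gamma> t) (\<eta> s)"
  show ?thesis
    by (rule tripodI[of r m l s' t'])
      (use * in \<open>simp_all add: assms(1)[of "\<eta> x" "\<gamma> y" for x y] add.commute\<close>)
qed

lemma tripod_cong:
  assumes "tripod d E C \<gamma> t \<eta> s"
    and "\<And>u. 0 \<le> u \<Longrightarrow> u \<le> t \<Longrightarrow> \<gamma>' u = \<gamma> u" and "\<And>u. 0 \<le> u \<Longrightarrow> u \<le> s \<Longrightarrow> \<eta>' u = \<eta> u"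
  shows "tripod d E C \<gamma>' t \<eta>' s"
  using assms(1)
proof (rule tripodE)
  fix r l m t' s'
  assume *: "0 \<le> r" "0 \<le> l" "0 \<le> m" "0 \<le> t'" "0 \<le> s'"
    "t = r + l + t'" "s = r + m + s'" "\<And>u. 0 \<le> u \<Longrightarrow> u \<le> r \<Longrightarrow> \<gamma> u = \<eta> u"
    and conv: "\<And>c. 0 \<le> c \<Longrightarrow> c \<le> 1 \<Longrightarrow>
       d (\<gamma> (r + c * l)) (\<eta> (r + c * m)) \<le> c * E * d (\<gamma> (r + l)) (\<eta> (r + m)) + C"
    and "t' + s' + d (\<gamma> (r + l)) (\<eta> (r + m)) \<le> d (\<gamma> t) (\<eta> s)"
  moreover have "c * l \<le> l" "c * m \<le> m" if "0 \<le> c" "c \<le> 1" for c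
    using that * by (auto simp: mult_left_le_one_le)
  ultimately show ?thesis
    by (intro tripodI[of r l m t' s']) (auto simp: assms add_increasing2 intro!: add_mono)
qed

lemma tripod_prepend:
  assumes "tripod d E C (\<lambda>u. \<gamma> (a + u)) t (\<lambda>u. \<eta> (a + u)) s" "0 \<le> a"
    and eq: "\<And>u. 0 \<le> u \<Longrightarrow> u \<le> a \<Longrightarrow> \<gamma> u = \<eta> u"
  shows "tripod d E C \<gamma> (a + t) \<eta> (a + s)"
  using assms(1)
proof (rule tripodE)
  fix r l m t' s'
  assume *: "0 \<le> r" "0 \<le> l" "0 \<le> m" "0 \<le> t'" "0 \<le> s'"
    "t = r + l + t'" "s = r + m + s'"
    "\<And>c. 0 \<le> c \<Longrightarrow> c \<le> 1 \<Longrightarrow> d (\<gamma> (a + (r + c * l))) (\<eta> (a + (r + c * m)))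
       \<le> c * E * d (\<gamma> (a + (r + l))) (\<eta> (a + (r + m))) + C"
    "t' + s' + d (\<gamma> (a + (r + l))) (\<eta> (a + (r + m))) \<le> d (\<gamma> (a + t)) (\<eta> (a + s))"
    and r: "\<And>u. 0 \<le> u \<Longrightarrow> u \<le> r \<Longrightarrow> \<gamma> (a + u) = \<eta> (a + u)"
  have "\<gamma> u = \<eta> u" if "0 \<le> u" "u \<le> a + r" for u
    using eq[of u] r[of "u - a"] that by (cases "u \<le> a") auto
  then show ?thesis
    by (intro tripodI[of "a + r" l m t' s']) (use * \<open>0 \<le> a\<close> in \<open>auto simp: add.assoc\<close>)
qed

text \<open>Only the tails grow; the last hypothesis says that the added lengths appear in full in
  the distance, as they do when both paths continue into different branches.\<close>

lemma tripod_extend: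
  assumes "tripod d E C \<gamma> t \<eta> s" "t \<le> t1" "s \<le> s1"
    and "d (\<gamma> t) (\<eta> s) + (t1 - t) + (s1 - s) \<le> d (\<gamma> t1) (\<eta> s1)"
  shows "tripod d E C \<gamma> t1 \<eta> s1"
  using assms(1)
proof (rule tripodE)
  fix r l m t' s'
  assume *: "0 \<le> r" "0 \<le> l" "0 \<le> m" "0 \<le> t'" "0 \<le> s'"
    "t = r + l + t'" "s = r + m + s'" "\<And>u. 0 \<le> u \<Longrightarrow> u \<le> r \<Longrightarrow> \<gamma> u = \<eta> u"
    "\<And>c. 0 \<le> c \<Longrightarrow> c \<le> 1 \<Longrightarrow>
       d (\<gamma> (r + c * l)) (\<eta> (r + c * m)) \<le> c * E * d (\<gamma> (r + l)) (\<eta> (r + m)) + C"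
    "t' + s' + d (\<gamma> (r + l)) (\<eta> (r + m)) \<le> d (\<gamma> t) (\<eta> s)"
  show ?thesis
    by (rule tripodI[of r l m "t' + (t1 - t)" "s' + (s1 - s)"])
      (use * assms(2-4) in \<open>auto\<close>)
qed

lemma tripod_mono:
  assumes "tripod d E C \<gamma> t \<eta> s" "E \<le> E'" "C \<le> C'" "\<And>x y. 0 \<le> d x y"
  shows "tripod d E' C' \<gamma> t \<eta> s"
  using assms(1)
proof (rule tripodE)
  fix r l m t' s'
  assume *: "0 \<le> r" "0 \<le> l" "0 \<le> m" "0 \<le> t'" "0 \<le> s'"
    "t = r + l + t'" "s = r + m + s'" "\<And>u. 0 \<le> u \<Longrightarrow> u \<le> r \<Longrightarrow> \<gamma> u = \<eta> u"
    "t' + s' + d (\<gamma> (r + l)) (\<eta> (r + m)) \<le> d (\<gamma> t) (\<eta> s)"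
    and conv: "\<And>c. 0 \<le> c \<Longrightarrow> c \<le> 1 \<Longrightarrow>
       d (\<gamma> (r + c * l)) (\<eta> (r + c * m)) \<le> c * E * d (\<gamma> (r + l)) (\<eta> (r + m)) + C"
  have "d (\<gamma> (r + c * l)) (\<eta> (r + c * m)) \<le> c * E' * d (\<gamma> (r + l)) (\<eta> (r + m)) + C'"
    if "0 \<le> c" "c \<le> 1" for c
  proof -
    have "c * E * d (\<gamma> (r + l)) (\<eta> (r + m)) \<le> c * E' * d (\<gamma> (r + l)) (\<eta> (r + m))"
      using that assms by (intro mult_right_mono mult_left_mono) auto
    then show ?thesis using conv[OF that] assms(3) by linarith
  qed
  then show ?thesis using * by (intro tripodI[of r l m t' s']) auto
qed

text \<open>Here one path is still running along the other. The separating piece degenerates to a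
  point, \<open>l = m = 0\<close>, and the rest of the longer path is the only tail.\<close>

lemma tripod_common:
  assumes "0 \<le> t" "0 \<le> s" "0 \<le> C"
    and "\<And>u. 0 \<le> u \<Longrightarrow> u \<le> t \<Longrightarrow> u \<le> s \<Longrightarrow> \<gamma> u = \<eta> u"
    and "\<And>u. 0 \<le> u \<Longrightarrow> u \<le> t \<Longrightarrow> d (\<gamma> t) (\<gamma> u) = t - u"
    and "\<And>u. 0 \<le> u \<Longrightarrow> u \<le> s \<Longrightarrow> d (\<eta> u) (\<eta> s) = s - u"
  shows "tripod d E C \<gamma> t \<eta> s"
proof (cases "s \<le> t")
  case True
  then have "\<gamma> s = \<eta> s" using assms(2,4) by simp
  then have "d (\<gamma> s) (\<eta> s) = 0" "d (\<gamma> t) (\<eta> s) = t - s"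
    using assms(5)[of s] assms(6)[of s] assms(2) True by simp_all
  then show ?thesis
    by (intro tripodI[of s 0 0 "t - s" 0]) (use True in \<open>simp_all add: assms(2-4)\<close>)
next
  case False
  then have "\<gamma> t = \<eta> t" using assms(1,4) by simp
  then have "d (\<gamma> t) (\<eta> t) = 0" "d (\<gamma> t) (\<eta> s) = s - t"
    using assms(5)[of t] assms(6)[of t] assms(1) False by simp_all
  then show ?thesis
    using False by (intro tripodI[of t 0 0 0 "s - t"]) (simp_all add: assms(1,3,4))
qed

text \<open>\<open>D\<close> models the distance between the two exit points of the separating
  piece, and \<open>k\<close> the fraction of that piece reached by the path that is less advanced.
  The conclusions bound the cost of using fraction \<open>k\<close> in place of the ratio
  \<open>c\<close>, and the cost of sliding the other path back to fraction
  \<open>k\<close>.\<close>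

lemma tripod_arith:
  fixes c :: real
  assumes "0 \<le> c" "c \<le> 1" "0 \<le> r" "0 \<le> l" "0 \<le> m" "0 \<le> t'" "0 \<le> s'" "0 \<le> k"
    and k1: "k * m = c * (r + m + s') - r" and k2: "k * l \<le> c * (r + l + t') - r"
    and D: "\<bar>l - m\<bar> \<le> D" "D \<le> l + m"
  shows "k * D \<le> c * (D + t' + s')" and "c * (r + l + t') - r - k * l \<le> c * (D + t' + s')"
proof -
  have cr: "c * r \<le> r" using assms by (simp add: mult_left_le_one_le)
  have nn: "0 \<le> c * D" "0 \<le> c * t'" "0 \<le> c * s'" using assms by auto
  show "k * D \<le> c * (D + t' + s')"
  proof (cases "k \<le> c")
    case True
    then have "k * D \<le> c * D" using D by (intro mult_right_mono) auto
    then show ?thesis using nn by (simp add: distrib_left)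
  next
    case False
    \<comment> \<open>By the sum of \<open>k1\<close> and \<open>k2\<close>,
      \<open>(k - c) * (l + m)\<close> is at most \<open>c * (t' + s') - 2 * (r - c * r)\<close>, so
      the tails absorb the excess.\<close>
    then have "(k - c) * D \<le> (k - c) * (l + m)" using D by (intro mult_left_mono) auto
    then show ?thesis using k1 k2 cr by (simp add: algebra_simps)
  qed
  show "c * (r + l + t') - r - k * l \<le> c * (D + t' + s')"
  proof (cases "l \<le> m")
    case True
    have "(c - k) * l \<le> r - c * r"
    proof (cases "k \<le> c")
      case True
      then have "(c - k) * l \<le> (c - k) * m" using \<open>l \<le> m\<close> by (intro mult_left_mono) auto
      then show ?thesis using k1 nn by (simp add: algebra_simps)
    next
      case False
      then have "(c - k) * l \<le> 0" using \<open>0 \<le> l\<close> by (intro mult_nonpos_nonneg) auto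
      then show ?thesis using cr by simp
    qed
    then show ?thesis using nn by (simp add: algebra_simps)
  next
    case False
    then have "k * m \<le> k * l" using \<open>0 \<le> k\<close> by (intro mult_left_mono) auto
    moreover have "c * (l - m) \<le> c * D" using D \<open>0 \<le> c\<close> by (intro mult_left_mono) auto
    ultimately show ?thesis using k1 nn by (simp add: algebra_simps)
  qed
qed

context Metric_space
begin

definition geodesic_on :: "(real \<Rightarrow> 'a) \<Rightarrow> real \<Rightarrow> bool" where
  "geodesic_on \<gamma> t \<longleftrightarrow> \<gamma> \<in> {0..t} \<rightarrow> M \<and> (\<forall>u\<in>{0..t}. \<forall>v\<in>{0..t}. d (\<gamma> u) (\<gamma> v) = \<bar>u - v\<bar>)"

text \<open>The point \<open>\<eta> (c * s)\<close> sits at fraction \<open>k\<close> of the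
  separating piece, and \<open>\<gamma> (c * t)\<close> is at least that far. Sliding
  \<open>\<gamma>\<close> back to fraction \<open>k\<close> costs at most
  \<open>c * d (\<gamma> t) (\<eta> s)\<close>, and the inequality inside the piece contributes
  \<open>E\<close> times that quantity plus \<open>C\<close>; together they give the factor
  \<open>E + 1\<close>.\<close>

lemma tripod_convex_aux:
  assumes geo: "geodesic_on \<gamma> t" "geodesic_on \<eta> s" and c: "0 \<le> c" "c \<le> 1" and E: "1 \<le> E"
    and r: "0 \<le> r" "0 \<le> l" "0 \<le> m" "0 \<le> t'" "0 \<le> s'" "t = r + l + t'" "s = r + m + s'"
    and "\<gamma> r = \<eta> r"
    and conv: "\<And>c. 0 \<le> c \<Longrightarrow> c \<le> 1 \<Longrightarrow>
       d (\<gamma> (r + c * l)) (\<eta> (r + c * m)) \<le> c * E * d (\<gamma> (r + l)) (\<eta> (r + m)) + C"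
    and split: "t' + s' + d (\<gamma> (r + l)) (\<eta> (r + m)) \<le> d (\<gamma> t) (\<eta> s)"
    and k: "0 \<le> k" "k \<le> 1" "k * m = c * s - r" "k * l \<le> c * t - r"
  shows "d (\<gamma> (c * t)) (\<eta> (c * s)) \<le> c * (E + 1) * d (\<gamma> t) (\<eta> s) + C"
proof -
  define D where "D = d (\<gamma> (r + l)) (\<eta> (r + m))"
  have "0 \<le> t" "0 \<le> s" using r by simp_all
  then have kl: "0 \<le> k * l" "k * l \<le> l" "0 \<le> k * m" "k * m \<le> m"
      "0 \<le> c * t" "c * t \<le> t" "c * s \<le> s" "0 \<le> c * s"
    using r(2,3) k(1,2) c by (simp_all add: mult_left_le_one_le)
  have M: "\<gamma> u \<in> M" if "0 \<le> u" "u \<le> t" for u using geo that by (auto simp: geodesic_on_def)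
  have M': "\<eta> u \<in> M" if "0 \<le> u" "u \<le> s" for u using geo that by (auto simp: geodesic_on_def)
  have "d (\<gamma> r) (\<gamma> (r + l)) = l" "d (\<eta> r) (\<eta> (r + m)) = m"
    using geo r by (auto simp: geodesic_on_def)
  note this(1) this(2)[folded \<open>\<gamma> r = \<eta> r\<close>]
  then have D: "D \<le> l + m" "\<bar>l - m\<bar> \<le> D"
    using triangle[of "\<gamma> (r + l)" "\<gamma> r" "\<eta> (r + m)"] triangle[of "\<gamma> r" "\<gamma> (r + l)" "\<eta> (r + m)"]
      triangle[of "\<gamma> r" "\<eta> (r + m)" "\<gamma> (r + l)"] M M' r
    by (auto simp: D_def commute abs_le_iff)
  have "d (\<gamma> (c * t)) (\<gamma> (r + k * l)) = c * t - r - k * l"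
    using geo kl k r by (auto simp: geodesic_on_def)
  moreover have "d (\<gamma> (r + k * l)) (\<eta> (r + k * m)) \<le> k * E * D + C"
    unfolding D_def by (rule conv) (use k in auto)
  moreover have "d (\<gamma> (c * t)) (\<eta> (c * s)) \<le>
      d (\<gamma> (c * t)) (\<gamma> (r + k * l)) + d (\<gamma> (r + k * l)) (\<eta> (c * s))"
    using kl k r by (intro triangle M M') auto
  moreover have "r + k * m = c * s" using k by simp
  ultimately have "d (\<gamma> (c * t)) (\<eta> (c * s)) \<le> c * t - r - k * l + k * E * D + C" by simp
  moreover have "k * D \<le> c * (D + t' + s')" "c * t - r - k * l \<le> c * (D + t' + s')"
    using tripod_arith[OF c r(1-5) k(1) _ _ D(2) D(1)] k r by auto
  moreover from this(1) have "k * E * D \<le> E * (c * (D + t' + s'))"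
    using E mult_left_mono[of "k * D" "c * (D + t' + s')" E] by (simp add: ac_simps)
  moreover have "(E + 1) * (c * (D + t' + s')) \<le> (E + 1) * (c * d (\<gamma> t) (\<eta> s))"
    using split c E by (intro mult_left_mono) (auto simp: D_def)
  ultimately show ?thesis by (simp add: algebra_simps)
qed

lemma tripod_convex:
  assumes tri: "tripod d E C \<gamma> t \<eta> s"
    and geo: "geodesic_on \<gamma> t" "geodesic_on \<eta> s" and c: "0 \<le> c" "c \<le> 1" and E: "1 \<le> E" "0 \<le> C"
  shows "d (\<gamma> (c * t)) (\<eta> (c * s)) \<le> c * (E + 1) * d (\<gamma> t) (\<eta> s) + C"
  using tri
proof (rule tripodE)
  fix r l m t' s'
  assume r: "0 \<le> r" "0 \<le> l" "0 \<le> m" "0 \<le> t'" "0 \<le> s'" "t = r + l + t'" "s = r + m + s'"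
    and eq: "\<And>u. 0 \<le> u \<Longrightarrow> u \<le> r \<Longrightarrow> \<gamma> u = \<eta> u"
    and conv: "\<And>c. 0 \<le> c \<Longrightarrow> c \<le> 1 \<Longrightarrow>
       d (\<gamma> (r + c * l)) (\<eta> (r + c * m)) \<le> c * E * d (\<gamma> (r + l)) (\<eta> (r + m)) + C"
    and split: "t' + s' + d (\<gamma> (r + l)) (\<eta> (r + m)) \<le> d (\<gamma> t) (\<eta> s)"
  have ct: "0 \<le> c * t" "c * t \<le> t" "c * s \<le> s" "0 \<le> c * s" "c * r \<le> r"
    using r c by (auto simp: mult_left_le_one_le)
  have M: "\<gamma> u \<in> M" if "0 \<le> u" "u \<le> t" for u using geo that by (auto simp: geodesic_on_def)
  have M': "\<eta> u \<in> M" if "0 \<le> u" "u \<le> s" for u using geo that by (auto simp: geodesic_on_def)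
  have dg: "d (\<gamma> u) (\<gamma> v) = \<bar>u - v\<bar>" if "0 \<le> u" "u \<le> t" "0 \<le> v" "v \<le> t" for u v
    using geo that by (auto simp: geodesic_on_def)
  have dh: "d (\<eta> u) (\<eta> v) = \<bar>u - v\<bar>" if "0 \<le> u" "u \<le> s" "0 \<le> v" "v \<le> s" for u v
    using geo that by (auto simp: geodesic_on_def)
  have grow: "c * d (\<gamma> t) (\<eta> s) \<le> c * (E + 1) * d (\<gamma> t) (\<eta> s)"
    using c E mult_left_mono[of 1 "E + 1" c] by (intro mult_right_mono) auto
  have "\<gamma> 0 = \<eta> 0" using eq r by simp
  then have "\<bar>t - s\<bar> \<le> d (\<gamma> t) (\<eta> s)"
    using triangle[of "\<gamma> 0" "\<gamma> t" "\<eta> s"] triangle[of "\<eta> 0" "\<eta> s" "\<gamma> t"] dg[of 0 t] dh[of 0 s] M M' r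
    by (auto simp: commute)
  then have ts: "\<bar>c * t - c * s\<bar> \<le> c * d (\<gamma> t) (\<eta> s)"
    using mult_left_mono[of "\<bar>t - s\<bar>" _ c] c by (simp add: abs_mult flip: right_diff_distrib)
  \<comment> \<open>A point on the common part, both points at or past the end of the piece, or the
    less advanced point strictly inside it. In the last two cases fractions are compared by cross
    multiplication, because \<open>l\<close> or \<open>m\<close> may vanish.\<close>
  consider "c * t \<le> r" | "c * s \<le> r" | "l \<le> c * t - r" "m \<le> c * s - r"
    | "r < c * s" "r < c * t" "c * s - r < m" "l * (c * s - r) \<le> m * (c * t - r)"
    | "r < c * s" "r < c * t" "c * t - r < l" "m * (c * t - r) \<le> l * (c * s - r)"
  proof -
    have "m * (c * t - r) \<le> l * (c * s - r)" if "c * t - r < l" "m \<le> c * s - r" "r < c * t"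
      using mult_mono[of m "c * s - r" "c * t - r" l] that r by (simp add: mult.commute)
    moreover have "l * (c * s - r) \<le> m * (c * t - r)" if "c * s - r < m" "l \<le> c * t - r" "r < c * s"
      using mult_mono[of l "c * t - r" "c * s - r" m] that r by (simp add: mult.commute)
    ultimately show ?thesis using that by argo
  qed
  then show ?thesis
  proof cases
    case 1
    then have "\<gamma> (c * t) = \<eta> (c * t)" using eq ct by simp
    moreover have "c * t \<le> s" using 1 r by simp
    ultimately have "d (\<gamma> (c * t)) (\<eta> (c * s)) = \<bar>c * t - c * s\<bar>" using dh ct by simp
    then show ?thesis using ts grow E by linarith
  next
    case 2
    then have "\<gamma> (c * s) = \<eta> (c * s)" using eq ct by simp
    moreover have "c * s \<le> t" using 2 r by simp
    ultimately have "d (\<gamma> (c * t)) (\<eta> (c * s)) = \<bar>c * t - c * s\<bar>"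
      using dg[of "c * t" "c * s"] ct by simp
    then show ?thesis using ts grow E by linarith
  next
    case 3
    define D where "D = d (\<gamma> (r + l)) (\<eta> (r + m))"
    have "\<gamma> r = \<eta> r" using eq r by simp
    moreover have "d (\<gamma> (r + l)) (\<gamma> r) = l" using dg r by simp
    moreover have "d (\<eta> r) (\<eta> (r + m)) = m" using dh r by simp
    ultimately have "D \<le> l + m"
      using triangle[of "\<gamma> (r + l)" "\<gamma> r" "\<eta> (r + m)"] M M' r by (simp add: D_def)
    \<comment> \<open>The scaled tails fall short of \<open>c * (t' + s')\<close> by at least
      \<open>(1 - c) * (l + m)\<close>, hence by \<open>(1 - c) * D\<close>. This reduces the full
      \<open>D\<close> on the way through the piece to \<open>c * D\<close>.\<close>
    then have "(1 - c) * D \<le> (1 - c) * (l + m)" using c by (intro mult_left_mono) auto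
    moreover have "d (\<gamma> (c * t)) (\<gamma> (r + l)) = c * t - (r + l)" using dg r 3 ct by simp
    moreover have "d (\<eta> (r + m)) (\<eta> (c * s)) = c * s - (r + m)" using dh r 3 ct by simp
    moreover have "d (\<gamma> (c * t)) (\<eta> (c * s)) \<le> d (\<gamma> (c * t)) (\<gamma> (r + l)) + d (\<gamma> (r + l)) (\<eta> (c * s))"
      "d (\<gamma> (r + l)) (\<eta> (c * s)) \<le> D + d (\<eta> (r + m)) (\<eta> (c * s))"
      unfolding D_def using r ct by (auto intro!: triangle M M')
    moreover have "c * (D + t' + s') \<le> c * d (\<gamma> t) (\<eta> s)"
      using split c by (intro mult_left_mono) (auto simp: D_def)
    ultimately have "d (\<gamma> (c * t)) (\<eta> (c * s)) \<le> c * d (\<gamma> t) (\<eta> s)"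
      using r ct by (simp add: algebra_simps)
    then show ?thesis using grow E by linarith
  next
    case 4
    then have "0 < m" by linarith
    then show ?thesis
      using 4 r by (intro tripod_convex_aux[OF geo c E(1) r _ conv split, of "(c * s - r) / m"])
        (auto simp: eq field_simps)
  next
    case 5
    then have "0 < l" by linarith
    then have "d (\<eta> (c * s)) (\<gamma> (c * t)) \<le> c * (E + 1) * d (\<eta> s) (\<gamma> t) + C"
      using 5 r split conv
      by (intro tripod_convex_aux[OF geo(2,1) c E(1) r(1,3,2,5,4,7,6), of _ "(c * t - r) / l"])
        (auto simp: eq field_simps commute[of "\<eta> _" "\<gamma> _"])
    then show ?thesis by (simp add: commute)
  qed
qed

end


section \<open>Spaces with tripod bicombings\<close>

text \<open>Values of \<open>G x y\<close> matter only on \<open>[0, d x y]\<close>. The tripod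
  condition ranges over all times and not only over endpoints, because convexity compares arbitrary
  points of two geodesics.\<close>

locale tripod_bicombing = Metric_space M d for M :: "'z set" and d +
  fixes G :: "'z \<Rightarrow> 'z \<Rightarrow> real \<Rightarrow> 'z" and E C :: real
  assumes E_ge_1: "1 \<le> E" and C_nonneg: "0 \<le> C"
    and path_in: "\<lbrakk>x \<in> M; y \<in> M; 0 \<le> t; t \<le> d x y\<rbrakk> \<Longrightarrow> G x y t \<in> M"
    and path_start: "\<lbrakk>x \<in> M; y \<in> M\<rbrakk> \<Longrightarrow> G x y 0 = x"
    and path_dist: "\<lbrakk>x \<in> M; y \<in> M; 0 \<le> t; t \<le> d x y; 0 \<le> s; s \<le> d x y\<rbrakk>
      \<Longrightarrow> d (G x y t) (G x y s) = \<bar>t - s\<bar>"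
    and path_reverse: "\<lbrakk>x \<in> M; y \<in> M; 0 \<le> t; t \<le> d x y\<rbrakk> \<Longrightarrow> G y x t = G x y (d x y - t)"
    and path_tripod: "\<lbrakk>p \<in> M; x \<in> M; y \<in> M; 0 \<le> t; t \<le> d p x; 0 \<le> s; s \<le> d p y\<rbrakk>
      \<Longrightarrow> tripod d E C (G p x) t (G p y) s"
begin

lemma path_end: "\<lbrakk>x \<in> M; y \<in> M\<rbrakk> \<Longrightarrow> G x y (d x y) = y"
  using path_reverse[of x y 0] path_start[of y x] by simp

lemma dist_path_start:
  "\<lbrakk>x \<in> M; y \<in> M; 0 \<le> t; t \<le> d x y\<rbrakk> \<Longrightarrow> d x (G x y t) = t"
  using path_dist[of x y 0 t] path_start[of x y] by simp

lemma geodesic_on_path: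
  "\<lbrakk>x \<in> M; y \<in> M; t \<le> d x y\<rbrakk> \<Longrightarrow> geodesic_on (G x y) t"
  unfolding geodesic_on_def by (auto simp: path_in path_dist)

lemma symmetric_geodesic_coarsely_convex: "symmetric_geodesic_coarsely_convex M d"
proof -
  define seg where "seg x y = (d x y, \<lambda>t\<in>{0..d x y}. G x y t)" for x y
  let ?L = "{seg x y |x y. x \<in> M \<and> y \<in> M}"
  have geo: "geodesic_segment M d (seg x y)" if "x \<in> M" "y \<in> M" for x y
    using that by (auto simp: geodesic_segment_def seg_def path_in path_dist)
  have ends: "seg x y \<in> ?L" "snd (seg x y) 0 = x" "snd (seg x y) (d x y) = y"
    if "x \<in> M" "y \<in> M" for x y
    using that by (auto simp: seg_def path_start path_end)
  have "\<exists>(a, \<gamma>)\<in>?L. \<gamma> 0 = x \<and> \<gamma> a = y" if "x \<in> M" "y \<in> M" for x y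
    using ends[OF that] by (intro bexI[of _ "seg x y"]) (auto simp: seg_def)
  \<comment> \<open>Segments are restricted to their interval, so reversal gives equal pairs and not
    merely functions agreeing on the interval.\<close>
  moreover have rev: "reverse_segment (seg x y) = seg y x" if "x \<in> M" "y \<in> M" for x y
    using that path_reverse[OF that]
    by (auto simp: reverse_segment_def seg_def commute[of y x] fun_eq_iff)
  moreover have "d (\<gamma> (c * t)) (\<eta> (c * s)) \<le> c * (E + 1) * d (\<gamma> t) (\<eta> s) + C"
    if L: "(a, \<gamma>) \<in> ?L" "(b, \<eta>) \<in> ?L" and eq: "\<gamma> 0 = \<eta> 0"
      and ts: "t \<in> {0..a}" "s \<in> {0..b}" "c \<in> {0..1}" for a \<gamma> b \<eta> t s c
  proof -
    obtain x y where xy: "x \<in> M" "y \<in> M" "(a, \<gamma>) = seg x y" using L(1) by blast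
    obtain x' z where z: "x' \<in> M" "z \<in> M" "(b, \<eta>) = seg x' z" using L(2) by blast
    have "\<gamma> 0 = x" "\<eta> 0 = x'" using ends xy z by (metis snd_conv)+
    then have "x' = x" using eq by simp
    have ct: "c * t \<le> t" "c * s \<le> s" "0 \<le> c * t" "0 \<le> c * s"
      using ts by (auto simp: mult_left_le_one_le)
    have a: "a = d x y" "b = d x z" "\<And>u. 0 \<le> u \<Longrightarrow> u \<le> d x y \<Longrightarrow> \<gamma> u = G x y u"
      "\<And>u. 0 \<le> u \<Longrightarrow> u \<le> d x z \<Longrightarrow> \<eta> u = G x z u"
      using xy z \<open>x' = x\<close> by (auto simp: seg_def)
    have "d (G x y (c * t)) (G x z (c * s)) \<le> c * (E + 1) * d (G x y t) (G x z s) + C"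
      using xy z ts a \<open>x' = x\<close> E_ge_1 C_nonneg
      by (intro tripod_convex path_tripod geodesic_on_path) auto
    then show ?thesis using a ct ts by auto
  qed
  ultimately have "\<forall>x\<in>M. \<forall>y\<in>M. \<exists>(a, \<gamma>)\<in>?L. \<gamma> 0 = x \<and> \<gamma> a = y"
    "\<forall>(a, \<gamma>)\<in>?L. \<forall>(b, \<eta>)\<in>?L. \<gamma> 0 = \<eta> 0 \<longrightarrow>
       (\<forall>t\<in>{0..a}. \<forall>s\<in>{0..b}. \<forall>c\<in>{0..1}.
          d (\<gamma> (c * t)) (\<eta> (c * s)) \<le> c * (E + 1) * d (\<gamma> t) (\<eta> s) + C)"
    by (blast, blast)
  moreover have "\<forall>g\<in>?L. reverse_segment g \<in> ?L"
  proof
    fix g assume "g \<in> ?L"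
    then obtain x y where "g = seg x y" "x \<in> M" "y \<in> M" by blast
    then show "reverse_segment g \<in> ?L" using rev ends(1) by simp
  qed
  moreover have "\<forall>g\<in>?L. geodesic_segment M d g" using geo by blast
  moreover have "1 \<le> E + 1" using E_ge_1 by simp
  ultimately show ?thesis
    unfolding symmetric_geodesic_coarsely_convex_def using Metric_space_axioms C_nonneg by blast
qed

lemma weaken:
  assumes "E \<le> E'" "C \<le> C'"
  shows "tripod_bicombing M d G E' C'"
proof
  fix p x y t s
  assume "p \<in> M" "x \<in> M" "y \<in> M" "0 \<le> t" "t \<le> d p x" "0 \<le> s" "s \<le> d p y"
  then show "tripod d E' C' (G p x) t (G p y) s"
    by (intro tripod_mono[OF path_tripod assms]) auto
qed (use assms E_ge_1 C_nonneg in \<open>auto simp: path_in path_start path_dist intro: path_reverse\<close>)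

end

text \<open>Coarse convexity is the tripod condition with the separating piece beginning at the
  common start and no tails, that is \<open>r = t' = s' = 0\<close>; hence the constants stay the
  same.\<close>

lemma ex_tripod_bicombing:
  assumes "symmetric_geodesic_coarsely_convex M d"
  obtains G E C where "tripod_bicombing M d G E C"
proof -
  interpret Metric_space M d
    using assms by (simp add: symmetric_geodesic_coarsely_convex_def)
  obtain E C L where EC: "1 \<le> E" "0 \<le> C"
    and geo: "\<forall>g\<in>L. geodesic_segment M d g"
    and ex: "\<forall>u\<in>M. \<forall>v\<in>M. \<exists>(a, \<gamma>)\<in>L. \<gamma> 0 = u \<and> \<gamma> a = v"
    and conv: "\<forall>(a, \<gamma>)\<in>L. \<forall>(b, \<eta>)\<in>L. \<gamma> 0 = \<eta> 0 \<longrightarrow>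
           (\<forall>t\<in>{0..a}. \<forall>s\<in>{0..b}. \<forall>c\<in>{0..1}.
              d (\<gamma> (c * t)) (\<eta> (c * s)) \<le> c * E * d (\<gamma> t) (\<eta> s) + C)"
    and rev: "\<forall>g\<in>L. reverse_segment g \<in> L"
    using assms unfolding symmetric_geodesic_coarsely_convex_def by (elim conjE exE)
  note geo = bspec[OF geo] and rev = bspec[OF rev]
  \<comment> \<open>choosing a segment for each unordered pair makes the choice symmetric\<close>
  define R where "R S = (SOME g. g \<in> L \<and> {snd g 0, snd g (fst g)} = S)" for S
  define G where "G x y t = (if snd (R {x, y}) 0 = x then snd (R {x, y}) t
      else snd (R {x, y}) (d x y - t))" for x y t
  have R: "R {x, y} \<in> L" "{snd (R {x, y}) 0, snd (R {x, y}) (fst (R {x, y}))} = {x, y}"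
    if xy: "x \<in> M" "y \<in> M" for x y
  proof -
    obtain a \<gamma> where "(a, \<gamma>) \<in> L" "\<gamma> 0 = x" "\<gamma> a = y" using bspec[OF bspec[OF ex xy(1)] xy(2)] by auto
    then have "\<exists>g. g \<in> L \<and> {snd g 0, snd g (fst g)} = {x, y}" by (intro exI[of _ "(a, \<gamma>)"]) auto
    from someI_ex[OF this]
    show "R {x, y} \<in> L" "{snd (R {x, y}) 0, snd (R {x, y}) (fst (R {x, y}))} = {x, y}"
      by (simp_all add: R_def)
  qed
  have lenR: "fst (R {x, y}) = d x y" if "x \<in> M" "y \<in> M" for x y
  proof -
    obtain a \<gamma> where g: "R {x, y} = (a, \<gamma>)" by fastforce
    then have "d (\<gamma> 0) (\<gamma> a) = a" "0 \<le> a"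
      using geo[OF R(1)[OF that]] by (auto simp: geodesic_segment_def)
    moreover have "\<gamma> 0 = x \<and> \<gamma> a = y \<or> \<gamma> 0 = y \<and> \<gamma> a = x"
      using R(2)[OF that] g by (auto simp: doubleton_eq_iff)
    ultimately show ?thesis using g by (auto simp: commute)
  qed
  have G: "\<exists>\<gamma>. (d x y, \<gamma>) \<in> L \<and> \<gamma> 0 = x \<and> (\<forall>t\<in>{0..d x y}. G x y t = \<gamma> t)"
    if xy: "x \<in> M" "y \<in> M" for x y
  proof (cases "snd (R {x, y}) 0 = x")
    case True
    moreover have "(d x y, snd (R {x, y})) \<in> L" using R(1)[OF xy] lenR[OF xy] by (metis prod.collapse)
    ultimately show ?thesis by (intro exI[of _ "snd (R {x, y})"]) (simp add: G_def)
  next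
    case False
    \<comment> \<open>The segment chosen for the unordered pair runs from \<open>y\<close> to
      \<open>x\<close>; its reversal is again in \<open>L\<close>, so it supplies the path from
      \<open>x\<close>.\<close>
    then have "snd (R {x, y}) (d x y) = x"
      using R(2)[OF xy] lenR[OF xy] by (auto simp: doubleton_eq_iff)
    moreover have "reverse_segment (R {x, y}) = (d x y, \<lambda>t\<in>{0..d x y}. snd (R {x, y}) (d x y - t))"
      using lenR[OF xy] by (simp add: reverse_segment_def split_beta)
    ultimately show ?thesis using rev[OF R(1)[OF xy]] False
      by (intro exI[of _ "\<lambda>t\<in>{0..d x y}. snd (R {x, y}) (d x y - t)"]) (auto simp: G_def)
  qed
  have "tripod_bicombing M d G E C"
  proof
    fix x y t s
    assume xy: "x \<in> M" "y \<in> M"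
    obtain \<gamma> where \<gamma>: "(d x y, \<gamma>) \<in> L" "\<gamma> 0 = x" "\<And>t. t\<in>{0..d x y} \<Longrightarrow> G x y t = \<gamma> t"
      using G[OF xy] by blast
    have g: "\<gamma> \<in> {0..d x y} \<rightarrow> M" "\<forall>t\<in>{0..d x y}. \<forall>s\<in>{0..d x y}. d (\<gamma> t) (\<gamma> s) = \<bar>t - s\<bar>"
      using geo[OF \<gamma>(1)] by (auto simp: geodesic_segment_def)
    show "G x y 0 = x" using \<gamma> by simp
    show "G x y t \<in> M" if "0 \<le> t" "t \<le> d x y" using g \<gamma>(3) that by auto
    show "d (G x y t) (G x y s) = \<bar>t - s\<bar>" if "0 \<le> t" "t \<le> d x y" "0 \<le> s" "s \<le> d x y"
      using g \<gamma>(3) that by auto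
    show "G y x t = G x y (d x y - t)" if t: "0 \<le> t" "t \<le> d x y"
    proof (cases "x = y")
      case True
      then show ?thesis using t xy by simp
    next
      case False
      have "R {y, x} = R {x, y}" by (simp add: insert_commute)
      then show ?thesis using R(2)[OF xy] False by (auto simp: G_def commute doubleton_eq_iff)
    qed
  next
    fix p x y t s
    assume p: "p \<in> M" "x \<in> M" "y \<in> M" "0 \<le> t" "t \<le> d p x" "0 \<le> s" "s \<le> d p y"
    obtain \<gamma> where \<gamma>: "(d p x, \<gamma>) \<in> L" "\<gamma> 0 = p" "\<And>t. t\<in>{0..d p x} \<Longrightarrow> G p x t = \<gamma> t"
      using G[OF p(1,2)] by blast
    obtain \<eta> where \<eta>: "(d p y, \<eta>) \<in> L" "\<eta> 0 = p" "\<And>t. t\<in>{0..d p y} \<Longrightarrow> G p y t = \<eta> t"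
      using G[OF p(1,3)] by blast
    have "tripod d E C \<gamma> t \<eta> s"
    proof (rule tripodI[of 0 t s 0 0])
      fix c :: real assume c: "0 \<le> c" "c \<le> 1"
      have "\<forall>t\<in>{0..d p x}. \<forall>s\<in>{0..d p y}. \<forall>c\<in>{0..1}.
          d (\<gamma> (c * t)) (\<eta> (c * s)) \<le> c * E * d (\<gamma> t) (\<eta> s) + C"
        using conv \<gamma>(1,2) \<eta>(1,2) by fastforce
      then show "d (\<gamma> (0 + c * t)) (\<eta> (0 + c * s)) \<le> c * E * d (\<gamma> (0 + t)) (\<eta> (0 + s)) + C"
        using p c by simp
    qed (use p \<gamma>(2) \<eta>(2) in auto)
    then show "tripod d E C (G p x) t (G p y) s"
      by (rule tripod_cong) (use \<gamma>(3) \<eta>(3) p in auto)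
  qed (use EC in auto)
  then show ?thesis using that by blast
qed

text \<open>Two paths from \<open>p\<close> run in equal or opposite directions, and in both cases
  distances scale exactly by \<open>c\<close>.\<close>

lemma tripod_bicombing_unit_interval:
  "tripod_bicombing {0..1::real} dist (\<lambda>x y t. if x \<le> y then x + t else x - t) 1 0"
proof -
  interpret Metric_space "{0..1::real}" dist by (rule Met_TC.subspace) simp
  show ?thesis
  proof
    fix p x y t s :: real
    assume *: "p \<in> {0..1}" "x \<in> {0..1}" "y \<in> {0..1}"
      "0 \<le> t" "t \<le> dist p x" "0 \<le> s" "s \<le> dist p y"
    have "\<bar>c * t - c * s\<bar> = c * \<bar>t - s\<bar>" "\<bar>c * t + c * s\<bar> = c * \<bar>t + s\<bar>"
        "\<bar>c * s - c * t\<bar> = c * \<bar>s - t\<bar>"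
        "\<bar>- (c * t) - c * s\<bar> = c * \<bar>t + s\<bar>" "\<bar>- (c * s) - c * t\<bar> = c * \<bar>s + t\<bar>"
      if "0 \<le> c" for c
      using that abs_mult[of c "t + s"]
      by (simp_all add: abs_mult abs_minus_commute[of "- (c * t)"] abs_minus_commute[of "- (c * s)"]
          distrib_left add.commute flip: right_diff_distrib)
    then show "tripod dist 1 0 (\<lambda>t. if p \<le> x then p + t else p - t) t
        (\<lambda>t. if p \<le> y then p + t else p - t) s"
      by (intro tripodI[of 0 t s 0 0]) (use * in \<open>auto simp: dist_real_def add.commute\<close>)
  qed (auto simp: dist_real_def split: if_splits)
qed


section \<open>Attaching pieces at points\<close>

text \<open>A single function \<open>d\<close> on the ambient type measures all pieces, so the wedge
  metric is recognised by additivity instead of being constructed. Additivity also forces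
  \<open>A\<close> and \<open>B i\<close> to meet only in \<open>b i\<close>. As a
  \<open>Metric_space\<close> on \<open>A\<close>, \<open>d\<close> is nonnegative and symmetric on
  the whole type, hence also for points of the branches.\<close>

locale wedge = tripod_bicombing A d G E C
  for A :: "'z set" and d and G :: "'z \<Rightarrow> 'z \<Rightarrow> real \<Rightarrow> 'z" and E C :: real +
  fixes I :: "'i set" and B :: "'i \<Rightarrow> 'z set" and b :: "'i \<Rightarrow> 'z"
    and H :: "'i \<Rightarrow> 'z \<Rightarrow> 'z \<Rightarrow> real \<Rightarrow> 'z"
  assumes branch: "i \<in> I \<Longrightarrow> tripod_bicombing (B i) d (H i) E C"
    and b_A: "i \<in> I \<Longrightarrow> b i \<in> A" and b_B: "i \<in> I \<Longrightarrow> b i \<in> B i"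
    and dist_A_B: "\<lbrakk>i \<in> I; x \<in> A; y \<in> B i\<rbrakk> \<Longrightarrow> d x y = d x (b i) + d (b i) y"
    and dist_B_B: "\<lbrakk>i \<in> I; j \<in> I; i \<noteq> j; x \<in> B i; y \<in> B j\<rbrakk>
      \<Longrightarrow> d x y = d x (b i) + d (b i) (b j) + d (b j) y"
begin

definition "W = A \<union> (\<Union>i\<in>I. B i)"

definition "br z = (SOME i. i \<in> I \<and> z \<in> B i)"

text \<open>A point of \<open>A\<close> counts as a piece of its own with height 0, so that one
  distance formula serves endpoints in \<open>A\<close> and in branches.\<close>

definition "piece z = (if z \<in> A then {z} else B (br z))"

definition "foot z = (if z \<in> A then z else b (br z))"

definition "ht z = d (foot z) z"

definition "stem z u = (if z \<in> A then z else H (br z) (b (br z)) z u)"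

definition "same x y \<longleftrightarrow> x \<notin> A \<and> y \<notin> A \<and> br x = br y"

text \<open>Down the stem of \<open>x\<close>, across \<open>A\<close>, and up the stem of
  \<open>y\<close>, unless both points lie in one branch outside \<open>A\<close>, whose own
  geodesic is then used.\<close>

definition "geo x y t =
  (if same x y then H (br x) x y t
   else if t \<le> ht x then stem x (ht x - t)
   else if t \<le> ht x + d (foot x) (foot y) then G (foot x) (foot y) (t - ht x)
   else stem y (t - ht x - d (foot x) (foot y)))"

lemma br: assumes "z \<in> W" "z \<notin> A" shows "br z \<in> I" "z \<in> B (br z)"
  using someI_ex[of "\<lambda>i. i \<in> I \<and> z \<in> B i"] assms unfolding W_def br_def by auto

lemma A_W: "x \<in> A \<Longrightarrow> x \<in> W" and B_W: "i \<in> I \<Longrightarrow> x \<in> B i \<Longrightarrow> x \<in> W"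
  by (auto simp: W_def)

lemma foot_A: "z \<in> W \<Longrightarrow> foot z \<in> A"
  by (auto simp: foot_def b_A br)

lemma ht_A: "z \<in> A \<Longrightarrow> ht z = 0"
  by (simp add: ht_def foot_def)

lemma ht_nonneg: "0 \<le> ht z"
  by (simp add: ht_def)

lemma in_piece: "z \<in> W \<Longrightarrow> z \<in> piece z"
  by (auto simp: piece_def br)

lemma piece_W: "z \<in> W \<Longrightarrow> x \<in> piece z \<Longrightarrow> x \<in> W"
  using br[of z] B_W[of "br z" x] by (auto simp: piece_def split: if_splits)

lemma dist_pieces:
  assumes "x \<in> W" "y \<in> W" "\<not> same x y" "p \<in> piece x" "q \<in> piece y"
  shows "d p q = d p (foot x) + d (foot x) (foot y) + d (foot y) q"
proof (cases "x \<in> A"; cases "y \<in> A")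
  assume "x \<in> A" "y \<in> A"
  then show ?thesis using assms by (auto simp: piece_def foot_def)
next
  assume "x \<in> A" "y \<notin> A"
  then show ?thesis using assms dist_A_B[of "br y" p q] br
    by (auto simp: piece_def foot_def)
next
  assume "x \<notin> A" "y \<in> A"
  then show ?thesis using assms dist_A_B[of "br x" q p] br
    by (auto simp: piece_def foot_def commute)
next
  assume "x \<notin> A" "y \<notin> A"
  then show ?thesis using assms dist_B_B[of "br x" "br y" p q] br
    by (auto simp: piece_def foot_def same_def)
qed

lemma dist_not_same:
  "\<lbrakk>x \<in> W; y \<in> W; \<not> same x y\<rbrakk> \<Longrightarrow> d x y = ht x + d (foot x) (foot y) + ht y"
  using dist_pieces[of x y x y] by (simp add: in_piece ht_def commute)

lemma dist_A_piece:
  "\<lbrakk>a \<in> A; y \<in> W; q \<in> piece y\<rbrakk> \<Longrightarrow> d a q = d a (foot y) + d (foot y) q"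
  using dist_pieces[of a y a q] by (auto simp: A_W same_def piece_def foot_def)

lemma stem:
  assumes "z \<in> W" "0 \<le> u" "u \<le> ht z"
  shows stem_piece: "stem z u \<in> piece z" and dist_foot_stem: "d (foot z) (stem z u) = u"
proof -
  have "stem z u \<in> piece z \<and> d (foot z) (stem z u) = u"
  proof (cases "z \<in> A")
    case True
    then show ?thesis using assms ht_A[OF True] by (simp add: piece_def stem_def foot_def)
  next
    case False
    interpret B: tripod_bicombing "B (br z)" d "H (br z)" E C
      using branch br assms False by blast
    show ?thesis
      using assms False br[of z] b_B[of "br z"] B.path_in[of "b (br z)" z u]
        B.dist_path_start[of "b (br z)" z u]
      by (simp add: piece_def stem_def foot_def ht_def)
  qed
  then show "stem z u \<in> piece z" "d (foot z) (stem z u) = u" by auto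
qed

lemma stem_W: "\<lbrakk>z \<in> W; 0 \<le> u; u \<le> ht z\<rbrakk> \<Longrightarrow> stem z u \<in> W"
  using stem_piece piece_W by blast

lemma dist_stem_stem_same:
  assumes "z \<in> W" "0 \<le> u" "u \<le> ht z" "0 \<le> v" "v \<le> ht z"
  shows "d (stem z u) (stem z v) = \<bar>u - v\<bar>"
proof (cases "z \<in> A")
  case True
  then show ?thesis using assms ht_A[OF True] by (simp add: stem_def)
next
  case False
  interpret B: tripod_bicombing "B (br z)" d "H (br z)" E C
    using branch br assms False by blast
  show ?thesis
    using assms False br[of z] b_B[of "br z"] B.path_dist[of "b (br z)" z u v]
    by (simp add: stem_def foot_def ht_def)
qed

lemma stem_0: assumes "z \<in> W" shows "stem z 0 = foot z"
proof (cases "z \<in> A")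
  case False
  interpret B: tripod_bicombing "B (br z)" d "H (br z)" E C
    using branch br assms False by blast
  show ?thesis
    using assms False br[of z] b_B[of "br z"] B.path_start by (simp add: stem_def foot_def)
qed (simp add: stem_def foot_def)

lemma stem_ht: assumes "z \<in> W" shows "stem z (ht z) = z"
proof (cases "z \<in> A")
  case False
  interpret B: tripod_bicombing "B (br z)" d "H (br z)" E C
    using branch br assms False by blast
  show ?thesis
    using assms False br[of z] b_B[of "br z"] B.path_end
    by (simp add: stem_def foot_def ht_def)
qed (simp add: stem_def foot_def)

lemma dist_A_stem:
  "\<lbrakk>a \<in> A; z \<in> W; 0 \<le> u; u \<le> ht z\<rbrakk> \<Longrightarrow> d a (stem z u) = d a (foot z) + u"
  using dist_A_piece[OF _ _ stem_piece] dist_foot_stem by metis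

lemma dist_stem_stem:
  assumes "x \<in> W" "y \<in> W" "\<not> same x y" "0 \<le> u" "u \<le> ht x" "0 \<le> v" "v \<le> ht y"
  shows "d (stem x u) (stem y v) = u + d (foot x) (foot y) + v"
  using dist_pieces[OF assms(1-3) stem_piece stem_piece] assms dist_foot_stem commute by metis

lemma same_sym: "same x y \<longleftrightarrow> same y x"
  by (auto simp: same_def)

lemma same_trans: "same x y \<Longrightarrow> same y z \<Longrightarrow> same x z"
  by (auto simp: same_def)

section \<open>The wedge is a metric space\<close>

lemma metric_W: "Metric_space W d"
proof
  fix x y assume xy: "x \<in> W" "y \<in> W"
  show "d x y = 0 \<longleftrightarrow> x = y"
  proof (cases "same x y")
    case True
    then interpret B: tripod_bicombing "B (br x)" d "H (br x)" E C
      using branch br xy by (auto simp: same_def)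
    have "x \<in> B (br x)" "y \<in> B (br x)" using True br[of x] br[of y] xy by (auto simp: same_def)
    then show ?thesis by (rule B.zero)
  next
    case False
    show ?thesis
    proof
      assume "d x y = 0"
      then have "ht x = 0" "d (foot x) (foot y) = 0" "ht y = 0"
        using dist_not_same[OF xy False] ht_nonneg[of x] ht_nonneg[of y]
          nonneg[of "foot x" "foot y"] by linarith+
      then show "x = y" using stem_0 stem_ht foot_A xy by (metis zero)
    next
      assume "x = y"
      then show "d x y = 0" using False by (auto simp: same_def)
    qed
  qed
  fix z assume z: "z \<in> W"
  have B_tri: "d p r \<le> d p q + d q r" if "i \<in> I" "p \<in> B i" "q \<in> B i" "r \<in> B i" for i p q r
    using Metric_space.triangle[OF tripod_bicombing.axioms(1)[OF branch]] that by blast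
  have ht_tri: "ht p \<le> d p q + ht q" if "same p q" "p \<in> W" "q \<in> W" for p q
  proof -
    have "br p \<in> I" "p \<in> B (br p)" "q \<in> B (br p)" "b (br p) \<in> B (br p)"
      using that br[of p] br[of q] b_B by (auto simp: same_def)
    then show ?thesis
      using that B_tri[of "br p" "b (br p)" q p] by (auto simp: ht_def foot_def same_def commute)
  qed
  have foot_same: "foot p = foot q" if "same p q" for p q
    using that by (auto simp: foot_def same_def)
  have foot_tri: "d (foot x) (foot z) \<le> d (foot x) (foot y) + d (foot y) (foot z)"
    using xy z foot_A by (intro triangle)
  \<comment> \<open>Symmetry and transitivity of \<open>same\<close> exclude the remaining patterns.
    In the fourth case the detour through \<open>y\<close> passes the attachment point on the way
    out and on the way back.\<close>
  consider "same x y" "same y z" | "same x y" "\<not> same y z" "\<not> same x z"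
    | "\<not> same x y" "same y z" "\<not> same x z" | "\<not> same x y" "\<not> same y z" "same x z"
    | "\<not> same x y" "\<not> same y z" "\<not> same x z"
    using same_sym same_trans by metis
  then show "d x z \<le> d x y + d y z"
  proof cases
    case 1
    then have "br x \<in> I" "x \<in> B (br x)" "y \<in> B (br x)" "z \<in> B (br x)"
      using br[of x] br[of y] br[of z] xy z by (auto simp: same_def)
    then show ?thesis using B_tri by blast
  next
    case 2
    then show ?thesis
      using dist_not_same xy z ht_tri[of x y] foot_same[of x y] by simp
  next
    case 3
    then show ?thesis
      using dist_not_same xy z ht_tri[of z y] foot_same[of y z] same_sym[of y z]
      by (simp add: commute)
  next
    case 4
    then have "br x \<in> I" "x \<in> B (br x)" "z \<in> B (br x)" "b (br x) \<in> B (br x)"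
      using br[of x] br[of z] xy z b_B by (auto simp: same_def)
    then have "d x z \<le> d x (b (br x)) + d (b (br x)) z" using B_tri by blast
    also have "\<dots> = ht x + ht z" using 4 by (auto simp: ht_def foot_def same_def commute)
    finally show ?thesis
      using dist_not_same[OF xy 4(1)] dist_not_same[OF xy(2) z 4(2)] ht_nonneg[of y]
        nonneg[of "foot x" "foot y"] nonneg[of "foot y" "foot z"] by linarith
  next
    case 5
    then show ?thesis using dist_not_same xy z foot_tri ht_nonneg[of y] by simp
  qed
qed (auto simp: commute)

section \<open>Concatenated paths are geodesics\<close>

context
  fixes x y assumes xy: "x \<in> W" "y \<in> W" "\<not> same x y"
begin

lemma geo_out: "0 \<le> t \<Longrightarrow> t \<le> ht x \<Longrightarrow> geo x y t = stem x (ht x - t)"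
  using xy by (simp add: geo_def)

lemma geo_across:
  assumes "0 \<le> t" "t \<le> d (foot x) (foot y)"
  shows "geo x y (ht x + t) = G (foot x) (foot y) t"
\<comment> \<open>At the joint the definition still takes the descending clause; both clauses give
  the foot of \<open>x\<close>.\<close>
proof (cases "t = 0")
  case True
  then show ?thesis using xy by (simp add: geo_def ht_nonneg stem_0 path_start foot_A)
qed (use assms xy in \<open>simp add: geo_def\<close>)

lemma geo_in_stem:
  assumes "0 \<le> t" "t \<le> ht y"
  shows "geo x y (ht x + d (foot x) (foot y) + t) = stem y t"
proof (cases "t = 0")
  case True
  then show ?thesis using geo_across[of "d (foot x) (foot y)"] xy
    by (simp add: stem_0 path_end foot_A)
next
  case False
  then have "\<not> ht x + d (foot x) (foot y) + t \<le> ht x + d (foot x) (foot y)"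
    "\<not> ht x + d (foot x) (foot y) + t \<le> ht x"
    using nonneg[of "foot x" "foot y"] assms(1) by linarith+
  then show ?thesis using xy by (simp add: geo_def)
qed

end

lemma geo_cases:
  assumes xy: "x \<in> W" "y \<in> W" "\<not> same x y" and "0 \<le> t" "t \<le> d x y"
  obtains (out) u where "0 \<le> u" "u \<le> ht x" "t = ht x - u" "geo x y t = stem x u"
    | (across) u where "0 \<le> u" "u \<le> d (foot x) (foot y)" "t = ht x + u"
        "geo x y t = G (foot x) (foot y) u"
    | (into) u where "0 \<le> u" "u \<le> ht y" "t = ht x + d (foot x) (foot y) + u"
        "geo x y t = stem y u"
proof -
  consider "t \<le> ht x" | "ht x < t" "t \<le> ht x + d (foot x) (foot y)"
    | "ht x + d (foot x) (foot y) < t" by linarith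
  then show thesis
  proof cases
    case 1
    then show ?thesis using assms geo_out[OF xy, of t] by (intro out[of "ht x - t"]) auto
  next
    case 2
    then show ?thesis using geo_across[OF xy, of "t - ht x"] by (intro across[of "t - ht x"]) auto
  next
    case 3
    then show ?thesis
      using geo_in_stem[OF xy, of "t - (ht x + d (foot x) (foot y))"] assms dist_not_same[OF xy]
      by (intro into[of "t - (ht x + d (foot x) (foot y))"]) auto
  qed
qed


lemma geo_W:
  assumes "x \<in> W" "y \<in> W" "0 \<le> t" "t \<le> d x y"
  shows "geo x y t \<in> W"
proof (cases "same x y")
  case True
  then have "br x \<in> I" "x \<in> B (br x)" "y \<in> B (br x)"
    using br[of x] br[of y] assms by (auto simp: same_def)
  then show ?thesis
    using True tripod_bicombing.path_in[OF branch] assms by (auto simp: geo_def intro!: B_W)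
next
  case False
  from geo_cases[OF assms(1,2) False assms(3,4)] show ?thesis
    by cases (use assms in \<open>auto simp: stem_W A_W path_in foot_A\<close>)
qed

lemma geo_W_dist:
  assumes "x \<in> W" "y \<in> W" "0 \<le> t" "t \<le> s" "s \<le> d x y"
  shows "d (geo x y t) (geo x y s) = s - t"
proof (cases "same x y")
  case True
  then have "br x \<in> I" "x \<in> B (br x)" "y \<in> B (br x)"
    using br[of x] br[of y] assms by (auto simp: same_def)
  then show ?thesis
    using True tripod_bicombing.path_dist[OF branch, of "br x" x y t s] assms
    by (auto simp: geo_def)
next
  case False
  note xy = assms(1,2) False
  have r: "foot x \<in> A" "foot y \<in> A" using assms foot_A by auto
  have t: "t \<le> d x y" and s: "0 \<le> s" using assms by auto
  have dG: "d (G (foot x) (foot y) u) (foot y) = d (foot x) (foot y) - u"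
    if "0 \<le> u" "u \<le> d (foot x) (foot y)" for u
    using path_dist[of "foot x" "foot y" u "d (foot x) (foot y)"] path_end[of "foot x" "foot y"]
      r that by simp
  show ?thesis
  proof (cases rule: geo_cases[OF xy assms(3) t, case_names out across into])
    case t: (out u)
    show ?thesis
    proof (cases rule: geo_cases[OF xy s assms(5), case_names out across into])
      case (out v)
      then show ?thesis using t dist_stem_stem_same[of x u v] assms by auto
    next
      case (across v)
      then show ?thesis
        using t dist_A_stem[of "G (foot x) (foot y) v" x u] assms r path_in
          dist_path_start[of "foot x" "foot y" v] by (simp add: commute)
    next
      case (into v)
      then show ?thesis using t dist_stem_stem[OF xy, of u v] by simp
    qed
  next
    case t: (across u)
    show ?thesis
    proof (cases rule: geo_cases[OF xy s assms(5), case_names out across into])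
      case (out v)
      \<comment> \<open>The ranges in \<open>geo_cases\<close> are closed, so the later time can be
        reported on the earlier part. With \<open>t \<le> s\<close> only the joint remains.\<close>
      then have "v = 0" "u = 0" using t assms by auto
      then show ?thesis using t out r xy by (simp add: stem_0 path_start)
    next
      case (across v)
      then show ?thesis using t assms r path_dist[of "foot x" "foot y" u v] by simp
    next
      case (into v)
      then show ?thesis
        using t dist_A_stem[of "G (foot x) (foot y) u" y v] assms r path_in dG[of u] by simp
    qed
  next
    case t: (into u)
    show ?thesis
    proof (cases rule: geo_cases[OF xy s assms(5), case_names out across into])
      case (out v)
      then have "v = 0" "u = 0" "d (foot x) (foot y) = 0"
        using t assms(4) nonneg[of "foot x" "foot y"] by linarith+
      then show ?thesis using t out r xy by (simp add: stem_0)
    next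
      case (across v)
      then have "v = d (foot x) (foot y)" "u = 0" using t assms by auto
      then show ?thesis using t across r xy by (simp add: stem_0 path_end)
    next
      case (into v)
      then show ?thesis using t dist_stem_stem_same[of y u v] assms by auto
    qed
  qed
qed

lemma geo_W_reverse:
  assumes "x \<in> W" "y \<in> W" "0 \<le> t" "t \<le> d x y"
  shows "geo y x t = geo x y (d x y - t)"
proof (cases "same x y")
  case True
  then have "br x \<in> I" "x \<in> B (br x)" "y \<in> B (br x)"
    using br[of x] br[of y] assms by (auto simp: same_def)
  then show ?thesis
    using True tripod_bicombing.path_reverse[OF branch, of "br x" x y t] assms
    by (auto simp: geo_def same_def)
next
  case False
  note xy = assms(1,2) False
  have yx: "y \<in> W" "x \<in> W" "\<not> same y x" using xy same_sym by auto
  have t: "0 \<le> d x y - t" "d x y - t \<le> d x y" using assms by auto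
  show ?thesis
  proof (cases rule: geo_cases[OF xy t, case_names out across into])
    case (out u)
    then have "t = ht y + d (foot y) (foot x) + u"
      using dist_not_same[OF xy] by (simp add: commute)
    then show ?thesis using out geo_in_stem[OF yx, of u] by simp
  next
    case (across u)
    then have "t = ht y + (d (foot x) (foot y) - u)"
      using dist_not_same[OF xy] by simp
    then show ?thesis
      using across geo_across[OF yx, of "d (foot x) (foot y) - u"] foot_A xy
        path_reverse[of "foot x" "foot y" "d (foot x) (foot y) - u"] by (simp add: commute)
  next
    case (into u)
    then have "t = ht y - u"
      using dist_not_same[OF xy] by simp
    then show ?thesis using into geo_out[OF yx, of t] assms by simp
  qed
qed

lemma geo_W_start:
  assumes "x \<in> W" "y \<in> W" shows "geo x y 0 = x"
proof (cases "same x y")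
  case True
  then have "br x \<in> I" "x \<in> B (br x)" "y \<in> B (br x)"
    using br[of x] br[of y] assms by (auto simp: same_def)
  then show ?thesis
    using True tripod_bicombing.path_start[OF branch] by (auto simp: geo_def)
next
  case False
  then show ?thesis using geo_out[OF assms False, of 0] assms by (simp add: ht_nonneg stem_ht)
qed

text \<open>After the shared descent both paths start at \<open>foot p\<close>. If \<open>x\<close>
  and \<open>y\<close> lie in one branch, the paths coincide up to its attachment point and separate
  inside it. Otherwise they separate in \<open>A\<close>, and the stems merely lengthen the
  tails.\<close>

lemma tripod_tails:
  assumes W: "p \<in> W" "x \<in> W" "y \<in> W" and px: "\<not> same p x" and py: "\<not> same p y"
    and t: "0 \<le> t" "t \<le> d (foot p) (foot x) + ht x"
    and s: "0 \<le> s" "s \<le> d (foot p) (foot y) + ht y"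
  shows "tripod d E C (\<lambda>u. geo p x (ht p + u)) t (\<lambda>u. geo p y (ht p + u)) s"
proof -
  define g h where "g = (\<lambda>u. geo p x (ht p + u))" and "h = (\<lambda>u. geo p y (ht p + u))"
  define a where "a z = d (foot p) (foot z)" for z
  have a0: "0 \<le> a z" for z by (simp add: a_def)
  note feet = W[THEN foot_A]
  have gG: "g u = G (foot p) (foot x) u" if "0 \<le> u" "u \<le> a x" for u
    using geo_across[OF W(1,2) px] that by (simp add: g_def a_def)
  have hG: "h u = G (foot p) (foot y) u" if "0 \<le> u" "u \<le> a y" for u
    using geo_across[OF W(1,3) py] that by (simp add: h_def a_def)
  have gS: "g (a x + u) = stem x u" if "0 \<le> u" "u \<le> ht x" for u
    using geo_in_stem[OF W(1,2) px] that by (simp add: g_def a_def add.assoc)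
  have hS: "h (a y + u) = stem y u" if "0 \<le> u" "u \<le> ht y" for u
    using geo_in_stem[OF W(1,3) py] that by (simp add: h_def a_def add.assoc)
  have "tripod d E C g t h s"
  proof (cases "same x y")
    case True
    have eq: "foot y = foot x" "br y = br x" "x \<notin> A" "y \<notin> A" "a y = a x"
      using True by (auto simp: same_def foot_def a_def)
    show ?thesis
    \<comment> \<open>As long as one of the paths has not gone past the attachment point, it is an
      initial part of the other.\<close>
    proof (cases "t \<le> a x \<or> s \<le> a x")
      case True
      show ?thesis
      proof (rule tripod_common)
        show "g u = h u" if "0 \<le> u" "u \<le> t" "u \<le> s" for u
          using True that gG[of u] hG[of u] eq by auto
        show "d (g t) (g u) = t - u" if "0 \<le> u" "u \<le> t" for u
          using geo_W_dist[OF W(1,2), of "ht p + u" "ht p + t"] dist_not_same[OF W(1,2) px]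
            that t ht_nonneg[of p] by (simp add: g_def commute)
        show "d (h u) (h s) = s - u" if "0 \<le> u" "u \<le> s" for u
          using geo_W_dist[OF W(1,3), of "ht p + u" "ht p + s"] dist_not_same[OF W(1,3) py]
            that s ht_nonneg[of p] by (simp add: h_def commute)
      qed (use t s C_nonneg in auto)
    next
      case False
      have "br x \<in> I" using br W eq by blast
      then interpret B: tripod_bicombing "B (br x)" d "H (br x)" E C by (rule branch)
      have B: "b (br x) \<in> B (br x)" "x \<in> B (br x)" "y \<in> B (br x)"
        using br[OF W(2)] br[OF W(3)] b_B eq by auto
      have htx: "ht x = d (b (br x)) x" and hty: "ht y = d (b (br x)) y"
        using eq by (auto simp: ht_def foot_def)
      have ts: "0 \<le> t - a x" "t - a x \<le> ht x" "0 \<le> s - a x" "s - a x \<le> ht y"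
        using t s False eq(1) by (simp_all add: a_def)
      have "tripod d E C (\<lambda>u. g (a x + u)) (t - a x) (\<lambda>u. h (a x + u)) (s - a x)"
      proof (rule tripod_cong)
        show "tripod d E C (H (br x) (b (br x)) x) (t - a x) (H (br x) (b (br x)) y) (s - a x)"
          using ts B htx hty by (intro B.path_tripod) simp_all
        show "g (a x + u) = H (br x) (b (br x)) x u" if "0 \<le> u" "u \<le> t - a x" for u
          using gS[of u] that ts eq by (simp add: stem_def)
        show "h (a x + u) = H (br x) (b (br x)) y u" if "0 \<le> u" "u \<le> s - a x" for u
          using hS[of u] that ts eq by (simp add: stem_def)
      qed
      then have "tripod d E C g (a x + (t - a x)) h (a x + (s - a x))"
      proof (rule tripod_prepend)
        show "g u = h u" if "0 \<le> u" "u \<le> a x" for u using gG[of u] hG[of u] that eq by simp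
      qed (rule a0)
      then show ?thesis by simp
    qed
  next
    case False
    \<comment> \<open>Times are cut off at the feet, so that both points lie in \<open>A\<close>;
      what remains of \<open>t\<close> and \<open>s\<close> is climbed on two different
      stems.\<close>
    define t0 s0 where "t0 = min t (a x)" and "s0 = min s (a y)"
    have ts0: "0 \<le> t0" "t0 \<le> a x" "t0 \<le> t" "0 \<le> s0" "s0 \<le> a y" "s0 \<le> s"
      using t s a0 by (auto simp: t0_def s0_def)
    have g0: "g t0 = G (foot p) (foot x) t0" and h0: "h s0 = G (foot p) (foot y) s0"
      using gG[of t0] hG[of s0] ts0 by auto
    have A: "g t0 \<in> A" "h s0 \<in> A"
      unfolding g0 h0 using ts0 feet by (auto simp: a_def intro!: path_in)
    have ga: "g (a x) = foot x" "h (a y) = foot y"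
      using gG[of "a x"] hG[of "a y"] a0 feet by (simp_all add: a_def path_end)
    have gt: "g t = g t0 \<and> t = t0 \<or> g t = stem x (t - t0) \<and> g t0 = foot x \<and> t - t0 \<le> ht x"
      using gS[of "t - a x"] t ga by (auto simp: t0_def min_def a_def)
    have hs: "h s = h s0 \<and> s = s0 \<or> h s = stem y (s - s0) \<and> h s0 = foot y \<and> s - s0 \<le> ht y"
      using hS[of "s - a y"] s ga by (auto simp: s0_def min_def a_def)
    have "tripod d E C g t0 h s0"
    proof (rule tripod_cong)
      show "tripod d E C (G (foot p) (foot x)) t0 (G (foot p) (foot y)) s0"
        using ts0 feet by (intro path_tripod) (auto simp: a_def)
    qed (use gG hG ts0 in auto)
    then show ?thesis
    proof (rule tripod_extend)
      have "d (stem x (t - t0)) (h s0) = d (foot x) (h s0) + (t - t0)" if "t - t0 \<le> ht x"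
        using dist_A_stem[OF A(2) W(2) _ that] ts0 by (simp add: commute)
      moreover have "d (g t0) (stem y (s - s0)) = d (g t0) (foot y) + (s - s0)" if "s - s0 \<le> ht y"
        using dist_A_stem[OF A(1) W(3) _ that] ts0 by simp
      moreover have "d (stem x (t - t0)) (stem y (s - s0)) =
          (t - t0) + d (foot x) (foot y) + (s - s0)" if "t - t0 \<le> ht x" "s - s0 \<le> ht y"
        using dist_stem_stem[OF W(2,3) False _ that(1) _ that(2)] ts0 by simp
      ultimately show "d (g t0) (h s0) + (t - t0) + (s - s0) \<le> d (g t) (h s)"
        using gt hs by auto
    qed (use ts0 in auto)
  qed
  then show ?thesis by (simp add: g_def h_def)
qed

text \<open>By reversal symmetry, the descent towards \<open>y\<close> is the chosen geodesic of the
  branch from \<open>p\<close> to the attachment point. It separates from the path to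
  \<open>x\<close> inside the branch, and what follows the attachment point only adds
  length.\<close>

lemma tripod_same_not_same:
  assumes W: "p \<in> W" "x \<in> W" "y \<in> W" and px: "same p x" and py: "\<not> same p y"
    and t: "0 \<le> t" "t \<le> d p x" and s: "0 \<le> s" "s \<le> d p y"
  shows "tripod d E C (geo p x) t (geo p y) s"
proof -
  have i: "br p \<in> I" "p \<in> B (br p)" "x \<in> B (br p)" "b (br p) \<in> B (br p)"
    and pA: "p \<notin> A" "piece p = B (br p)" "foot p = b (br p)"
    using br[of p] br[of x] W px b_B by (auto simp: same_def piece_def foot_def)
  interpret B: tripod_bicombing "B (br p)" d "H (br p)" E C using i(1) by (rule branch)
  have ht: "ht p = d p (b (br p))" using pA by (simp add: ht_def commute)
  define s0 where "s0 = min s (ht p)"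
  have s0: "0 \<le> s0" "s0 \<le> s" "s0 \<le> ht p" using s ht_nonneg[of p] by (auto simp: s0_def)
  have z: "geo p x t \<in> piece p" using px i t B.path_in by (simp add: geo_def pA)
  have "tripod d E C (geo p x) t (geo p y) s0"
  proof (rule tripod_cong)
    show "tripod d E C (H (br p) p x) t (H (br p) p (b (br p))) s0"
      using i t s0 ht by (intro B.path_tripod) auto
    show "geo p x u = H (br p) p x u" for u using px by (simp add: geo_def)
    show "geo p y u = H (br p) p (b (br p)) u" if "0 \<le> u" "u \<le> s0" for u
      using geo_out[OF W(1,3) py, of u] B.path_reverse[of p "b (br p)" "ht p - u"] i that s0 pA ht
      by (simp add: stem_def)
  qed
  then show ?thesis
  proof (rule tripod_extend)
    show "d (geo p x t) (geo p y s0) + (t - t) + (s - s0) \<le> d (geo p x t) (geo p y s)"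
    proof (cases "s \<le> ht p")
      case False
      then have "s0 = ht p" by (simp add: s0_def)
      moreover have "geo p y (ht p) = foot p"
        using geo_out[OF W(1,3) py, of "ht p"] ht_nonneg[of p] stem_0 W by simp
      moreover have "d (geo p x t) (geo p y s) = d (geo p x t) (foot p) + (s - ht p)"
      proof (cases rule: geo_cases[OF W(1,3) py s, case_names out across into])
        case (out u)
        then show ?thesis using False by simp
      next
        case (across u)
        then show ?thesis
          using dist_A_piece[OF _ W(1) z, of "geo p y s"] foot_A W path_in
            dist_path_start[of "foot p" "foot y" u] by (simp add: commute)
      next
        case (into u)
        then show ?thesis
          using dist_pieces[OF W(1,3) py z stem_piece[OF W(3)], of u] dist_foot_stem[OF W(3), of u]
          by simp
      qed
      ultimately show ?thesis by simp
    qed (simp add: s0_def)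
  qed (use s0 in auto)
qed

lemma geo_W_tripod:
  assumes W: "p \<in> W" "x \<in> W" "y \<in> W"
    and t: "0 \<le> t" "t \<le> d p x" and s: "0 \<le> s" "s \<le> d p y"
  shows "tripod d E C (geo p x) t (geo p y) s"
proof (cases "same p x"; cases "same p y")
  assume *: "same p x" "same p y"
  then have i: "br p \<in> I" "p \<in> B (br p)" "x \<in> B (br p)" "y \<in> B (br p)"
    using br[of p] br[of x] br[of y] W by (auto simp: same_def)
  interpret B: tripod_bicombing "B (br p)" d "H (br p)" E C using i(1) by (rule branch)
  have "geo p x = H (br p) p x" "geo p y = H (br p) p y"
    using * by (auto simp: geo_def fun_eq_iff)
  then show ?thesis using i t s B.path_tripod by simp
next
  assume "same p x" "\<not> same p y"
  then show ?thesis using tripod_same_not_same assms by blast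
next
  assume "\<not> same p x" "same p y"
  then have "tripod d E C (geo p y) s (geo p x) t" using tripod_same_not_same assms by blast
  then show ?thesis using tripod_sym[of d] commute by metis
next
  assume px: "\<not> same p x" and py: "\<not> same p y"
  show ?thesis
  proof (cases "t \<le> ht p \<or> s \<le> ht p")
    case True
    show ?thesis
    proof (rule tripod_common)
      show "geo p x u = geo p y u" if "0 \<le> u" "u \<le> t" "u \<le> s" for u
        using True that geo_out[OF W(1,2) px, of u] geo_out[OF W(1,3) py, of u] by auto
      show "d (geo p x t) (geo p x u) = t - u" if "0 \<le> u" "u \<le> t" for u
        using geo_W_dist[OF W(1,2), of u t] that t by (simp add: commute)
      show "d (geo p y u) (geo p y s) = s - u" if "0 \<le> u" "u \<le> s" for u
        using geo_W_dist[OF W(1,3), of u s] that s by simp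
    qed (use t s C_nonneg in auto)
  next
    case False
    have "tripod d E C (geo p x) (ht p + (t - ht p)) (geo p y) (ht p + (s - ht p))"
    proof (rule tripod_prepend)
      show "tripod d E C (\<lambda>u. geo p x (ht p + u)) (t - ht p) (\<lambda>u. geo p y (ht p + u)) (s - ht p)"
        using False t s W dist_not_same[OF W(1,2) px] dist_not_same[OF W(1,3) py]
        by (intro tripod_tails[OF W px py]) auto
      show "geo p x u = geo p y u" if "0 \<le> u" "u \<le> ht p" for u
        using that geo_out[OF W(1,2) px, of u] geo_out[OF W(1,3) py, of u] by auto
    qed (rule ht_nonneg)
    then show ?thesis by simp
  qed
qed

lemma tripod_bicombing_W: "tripod_bicombing W d geo E C"
proof -
  interpret W: Metric_space W d by (rule metric_W)
  show ?thesis
  proof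
    show "d (geo x y t) (geo x y s) = \<bar>t - s\<bar>"
      if "x \<in> W" "y \<in> W" "0 \<le> t" "t \<le> d x y" "0 \<le> s" "s \<le> d x y" for x y t s
      using geo_W_dist[of x y t s] geo_W_dist[of x y s t] that
      by (cases "t \<le> s") (auto simp: commute)
  qed (use E_ge_1 C_nonneg geo_W geo_W_start geo_W_tripod in \<open>auto intro: geo_W_reverse\<close>)
qed

text \<open>Attaching pieces keeps the old geodesics; without this the choices of successive stages
  would not fit together in the union.\<close>

lemma geo_A: "x \<in> A \<Longrightarrow> y \<in> A \<Longrightarrow> 0 \<le> t \<Longrightarrow> t \<le> d x y \<Longrightarrow> geo x y t = G x y t"
  using geo_across[of x y t] A_W ht_A[of x] by (simp add: same_def foot_def)

end

section \<open>Increasing unions and isometric images\<close>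

lemma tripod_bicombing_cong:
  assumes "tripod_bicombing M d G E C"
    and eq: "\<And>x y t. \<lbrakk>x \<in> M; y \<in> M; 0 \<le> t; t \<le> d x y\<rbrakk> \<Longrightarrow> G' x y t = G x y t"
  shows "tripod_bicombing M d G' E C"
proof -
  interpret tripod_bicombing M d G E C by fact
  show ?thesis
  proof
    fix x y t assume xy: "x \<in> M" "y \<in> M"
    show "G' x y 0 = x" using eq xy path_start by simp
    assume t: "0 \<le> t" "t \<le> d x y"
    show "G' x y t \<in> M" using eq xy t path_in by simp
    show "d (G' x y t) (G' x y s) = \<bar>t - s\<bar>" if "0 \<le> s" "s \<le> d x y" for s
      using eq xy t that path_dist by simp
    show "G' y x t = G' x y (d x y - t)"
      using eq[of y x t] eq[of x y "d x y - t"] xy t path_reverse[of x y t] by (simp add: commute)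
  next
    fix p x y t s
    assume *: "p \<in> M" "x \<in> M" "y \<in> M" "0 \<le> t" "t \<le> d p x" "0 \<le> s" "s \<le> d p y"
    show "tripod d E C (G' p x) t (G' p y) s"
      by (rule tripod_cong[OF path_tripod[OF *]]) (use * eq in auto)
  qed (use E_ge_1 C_nonneg in auto)
qed

text \<open>Each condition involves at most three points, which lie in a common stage. Dependent
  choice is used because the bicombing of a stage must extend the one chosen before.\<close>

lemma tripod_bicombing_Union:
  fixes A :: "nat \<Rightarrow> 'z set"
  assumes "tripod_bicombing (A 0) d G E C"
    and step: "\<And>n G. tripod_bicombing (A n) d G E C \<Longrightarrow>
      \<exists>G'. tripod_bicombing (A (Suc n)) d G' E C \<and>
        (\<forall>x\<in>A n. \<forall>y\<in>A n. \<forall>t\<in>{0..d x y}. G' x y t = G x y t)"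
    and inc: "\<And>n. A n \<subseteq> A (Suc n)"
  obtains G where "tripod_bicombing (\<Union>n. A n) d G E C"
proof -
  obtain F where F: "\<And>n. tripod_bicombing (A n) d (F n) E C"
    and FS: "\<And>n. \<forall>x\<in>A n. \<forall>y\<in>A n. \<forall>t\<in>{0..d x y}. F (Suc n) x y t = F n x y t"
    using dependent_nat_choice[of "\<lambda>n G. tripod_bicombing (A n) d G E C"
        "\<lambda>n G G'. \<forall>x\<in>A n. \<forall>y\<in>A n. \<forall>t\<in>{0..d x y}. G' x y t = G x y t"] assms by metis
  have mono: "A m \<subseteq> A n" if "m \<le> n" for m n using lift_Suc_mono_le[of A, OF inc that] .
  have Fmn: "F n x y t = F m x y t"
    if "m \<le> n" "x \<in> A m" "y \<in> A m" "0 \<le> t" "t \<le> d x y" for m n x y t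
    using that(1)
  proof (induction rule: dec_induct)
    case (step n)
    then have "x \<in> A n" "y \<in> A n" using mono that by auto
    then show ?case using FS[of n] step that by simp
  qed simp
  \<comment> \<open>The first stage containing both endpoints decides; every later stage gives the
    same values between them.\<close>
  define G where "G x y = F (LEAST n. x \<in> A n \<and> y \<in> A n) x y" for x y
  have G: "G x y t = F n x y t"
    if "x \<in> A n" "y \<in> A n" "0 \<le> t" "t \<le> d x y" for n x y t
  proof -
    have "\<exists>m. (LEAST n. x \<in> A n \<and> y \<in> A n) = m \<and> m \<le> n \<and> x \<in> A m \<and> y \<in> A m"
      using LeastI[of "\<lambda>n. x \<in> A n \<and> y \<in> A n" n] Least_le[of "\<lambda>n. x \<in> A n \<and> y \<in> A n" n]
        that by auto
    then show ?thesis using Fmn[of _ n x y t] that by (auto simp: G_def)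
  qed
  have tb: "tripod_bicombing (A n) d G E C" for n
    by (rule tripod_bicombing_cong[OF F[of n]]) (rule G)
  have common: "\<exists>n. x \<in> A n \<and> y \<in> A n \<and> z \<in> A n"
    if xyz: "x \<in> (\<Union>n. A n)" "y \<in> (\<Union>n. A n)" "z \<in> (\<Union>n. A n)" for x y z
  proof -
    obtain i j k where "x \<in> A i" "y \<in> A j" "z \<in> A k" using xyz by blast
    then show ?thesis using mono[of i "max i (max j k)"] mono[of j "max i (max j k)"]
      mono[of k "max i (max j k)"] by (intro exI[of _ "max i (max j k)"]) fastforce
  qed
  interpret A0: tripod_bicombing "A 0" d G E C by (rule tb)
  have "tripod_bicombing (\<Union>n. A n) d G E C"
  proof
    fix x y assume xy: "x \<in> (\<Union>n. A n)" "y \<in> (\<Union>n. A n)"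
    then obtain n where n: "x \<in> A n" "y \<in> A n" using common[of x y y] by blast
    interpret An: tripod_bicombing "A n" d G E C by (rule tb)
    show "d x y = 0 \<longleftrightarrow> x = y" using n by simp
    show "G x y 0 = x" using An.path_start n by simp
    fix t assume t: "0 \<le> t" "t \<le> d x y"
    show "G x y t \<in> (\<Union>n. A n)" using An.path_in n t by auto
    show "G y x t = G x y (d x y - t)" using An.path_reverse n t by simp
    fix s assume s: "0 \<le> s" "s \<le> d x y"
    show "d (G x y t) (G x y s) = \<bar>t - s\<bar>" using An.path_dist n t s by simp
  next
    fix p x y assume "p \<in> (\<Union>n. A n)" "x \<in> (\<Union>n. A n)" "y \<in> (\<Union>n. A n)"
    then obtain n where n: "p \<in> A n" "x \<in> A n" "y \<in> A n" using common[of p x y] by blast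
    interpret An: tripod_bicombing "A n" d G E C by (rule tb)
    show "d p y \<le> d p x + d x y" using An.triangle n by simp
    fix t s assume "0 \<le> t" "t \<le> d p x" "0 \<le> s" "s \<le> d p y"
    then show "tripod d E C (G p x) t (G p y) s" using An.path_tripod n by simp
  qed (use A0.E_ge_1 A0.C_nonneg A0.commute in auto)
  then show ?thesis using that by blast
qed

text \<open>Transports the geodesics of \<open>X\<close>, of \<open>Y\<close> and of the unit
  interval to their copies in the quotient. Injectivity of \<open>f\<close> follows from the
  isometry, so paths can be pulled back along the inverse.\<close>

lemma tripod_bicombing_image:
  assumes "tripod_bicombing M dM G E C"
    and iso: "\<And>x y. x \<in> M \<Longrightarrow> y \<in> M \<Longrightarrow> d (f x) (f y) = dM x y"
    and d_nonneg: "\<And>x y. 0 \<le> d x y" and d_commute: "\<And>x y. d x y = d y x"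
  shows "tripod_bicombing (f ` M) d
    (\<lambda>x y t. f (G (inv_into M f x) (inv_into M f y) t)) E C"
proof -
  interpret tripod_bicombing M dM G E C by fact
  have "inj_on f M"
    using iso by (intro inj_onI) (metis zero)
  then have inv: "inv_into M f (f x) = x" if "x \<in> M" for x using that by simp
  show ?thesis
  proof
    fix x y z assume "x \<in> f ` M" "y \<in> f ` M" "z \<in> f ` M"
    then show "d x z \<le> d x y + d y z" using triangle by (auto simp: iso)
  next
    fix x y assume "x \<in> f ` M" "y \<in> f ` M"
    then show "d x y = 0 \<longleftrightarrow> x = y" by (auto simp: iso)
  next
    fix p x y t s
    assume "p \<in> f ` M" "x \<in> f ` M" "y \<in> f ` M"
    then obtain p' x' y' where [simp]: "p = f p'" "x = f x'" "y = f y'"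
      and M: "p' \<in> M" "x' \<in> M" "y' \<in> M" by blast
    assume ts: "0 \<le> t" "t \<le> d p x" "0 \<le> s" "s \<le> d p y"
    have "tripod dM E C (G p' x') t (G p' y') s"
      using ts M by (intro path_tripod) (auto simp: iso)
    then have "tripod d E C (\<lambda>u. f (G p' x' u)) t (\<lambda>u. f (G p' y' u)) s"
    proof (rule tripodE)
      fix r l m t' s'
      assume *: "0 \<le> r" "0 \<le> l" "0 \<le> m" "0 \<le> t'" "0 \<le> s'" "t = r + l + t'" "s = r + m + s'"
        and eq: "\<And>u. 0 \<le> u \<Longrightarrow> u \<le> r \<Longrightarrow> G p' x' u = G p' y' u"
        and conv: "\<And>c. 0 \<le> c \<Longrightarrow> c \<le> 1 \<Longrightarrow> dM (G p' x' (r + c * l)) (G p' y' (r + c * m))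
          \<le> c * E * dM (G p' x' (r + l)) (G p' y' (r + m)) + C"
        and split: "t' + s' + dM (G p' x' (r + l)) (G p' y' (r + m)) \<le> dM (G p' x' t) (G p' y' s)"
      have ts': "t \<le> dM p' x'" "s \<le> dM p' y'" using ts M by (auto simp: iso)
      have d: "d (f (G p' x' u)) (f (G p' y' v)) = dM (G p' x' u) (G p' y' v)"
        if "0 \<le> u" "u \<le> t" "0 \<le> v" "v \<le> s" for u v
        using M that ts' by (intro iso path_in) auto
      have cl: "0 \<le> c * l" "c * l \<le> l" "0 \<le> c * m" "c * m \<le> m" if "0 \<le> c" "c \<le> 1" for c
        using that * by (auto simp: mult_left_le_one_le)
      show ?thesis
      proof (rule tripodI[OF *])
        show "f (G p' x' u) = f (G p' y' u)" if "0 \<le> u" "u \<le> r" for u using eq that by simp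
        show "d (f (G p' x' (r + c * l))) (f (G p' y' (r + c * m)))
            \<le> c * E * d (f (G p' x' (r + l))) (f (G p' y' (r + m))) + C" if "0 \<le> c" "c \<le> 1" for c
          using conv[OF that] cl[OF that] d[of "r + c * l" "r + c * m"] d[of "r + l" "r + m"] *
          by simp
        show "t' + s' + d (f (G p' x' (r + l))) (f (G p' y' (r + m)))
            \<le> d (f (G p' x' t)) (f (G p' y' s))"
          using split d[of "r + l" "r + m"] d[of t s] * by simp
      qed
    qed
    then show "tripod d E C (\<lambda>t. f (G (inv_into M f p) (inv_into M f x) t)) t
        (\<lambda>t. f (G (inv_into M f p) (inv_into M f y) t)) s"
      using M by (simp add: inv)
  qed (use E_ge_1 C_nonneg in
      \<open>auto simp: inv iso path_in path_start path_dist d_nonneg d_commute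
        intro!: arg_cong[of _ _ f] path_reverse\<close>)
qed


section \<open>The free product as a tree of sheets and edges\<close>

locale free_product_nets =
  free_product X dX X0 iX eX epsX Y dY Y0 iY eY epsY + X: Metric_space X dX + Y: Metric_space Y dY
  for X :: "'a set" and dX and X0 :: "'i set" and iX eX epsX
    and Y :: "'b set" and dY and Y0 :: "'j set" and iY eY epsY +
  assumes iX: "x \<in> X0 \<Longrightarrow> iX x \<in> X" and iY: "y \<in> Y0 \<Longrightarrow> iY y \<in> Y"
    and eX: "eX \<in> X" and eY: "eY \<in> Y"
begin

lemma isl_index [simp]: "isl (index z) = isl z"
  by (cases z) auto

lemma nrm_nonneg [simp]: "0 \<le> nrm u"
  by (cases u) auto

lemma dist_same_word_nonneg [simp]: "0 \<le> dist_same_word u v"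
  by (cases u; cases v) auto

lemma dist_same_word_commute: "dist_same_word u v = dist_same_word v u"
  by (cases u; cases v) (auto simp: X.commute Y.commute)

text \<open>The point where a route from the sheets over the empty word to \<open>(w, u)\<close>
  leaves them; \<open>height\<close> is the length of the rest. Each letter costs an edge of length
  1 and the way from the base point of the new sheet to the next exit.\<close>

fun first :: "('i, 'j) word \<Rightarrow> 'a + 'b \<Rightarrow> 'a + 'b" where
  "first [] u = u"
| "first (z # w) u = index z"

fun height :: "('i, 'j) word \<Rightarrow> 'a + 'b \<Rightarrow> real" where
  "height [] u = 0"
| "height (z # w) u = 1 + nrm (first w u) + height w u"

lemma height_nonneg [simp]: "0 \<le> height w u"
  by (induction w) auto

lemma height_eq: "w \<noteq> [] \<Longrightarrow> height w u = word_length w + nrm u"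
proof (induction w)
  case (Cons z w)
  show ?case
  proof (cases w)
    case Nil
    then show ?thesis by (simp add: word_length_def)
  next
    case (Cons z' w')
    have "(\<Sum>i = 1..<length (z # w). nrm (index ((z # w) ! i))) =
        (\<Sum>i = 0..<length w. nrm (index (w ! i)))"
      using sum.shift_bounds_Suc_ivl[of "\<lambda>i. nrm (index ((z # w) ! i))" 0 "length w"] by simp
    also have "\<dots> = nrm (index z') + (\<Sum>i = 1..<length w. nrm (index (w ! i)))"
      using Cons by (simp add: sum.atLeast_Suc_lessThan)
    finally show ?thesis using Cons Cons.IH by (simp add: word_length_def)
  qed
qed simp

lemma first_append: "first (w @ z # s) v = first w (index z)"
  by (cases w) auto

lemma height_append: "height (w @ z # s) v = height w (index z) + height (z # s) v"
  by (induction w) (auto simp: first_append)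

lemma dist_sheets_Cons [simp]:
  "dist_sheets (z # w, u) (z # w', v) = dist_sheets (w, u) (w', v)"
  by (simp add: dist_sheets_def Let_def)

text \<open>Once the common prefix is stripped, \<open>first\<close> and \<open>height\<close> merge
  all cases of the metric on sheets into one formula.\<close>

lemma dist_sheets_diverge:
  assumes "w = [] \<or> w' = [] \<or> hd w \<noteq> hd w'"
  shows "dist_sheets (w, u) (w', v) =
    dist_same_word (first w u) (first w' v) + height w u + height w' v"
proof (cases w; cases w')
  fix z r z' r' assume *: "w = z # r" "w' = z' # r'"
  then have "longest_common_prefix w w' = []" using assms by auto
  then show ?thesis using * height_eq[of w u] height_eq[of w' v]
    by (simp add: dist_sheets_def del: height.simps)
qed (auto simp: dist_sheets_def height_eq[symmetric] dist_same_word_commute simp del: height.simps(2))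

lemma dist_sheets_induct [case_names Cons diverge]:
  assumes "\<And>z w w'. P w w' \<Longrightarrow> P (z # w) (z # w')"
    and "\<And>w w'. w = [] \<or> w' = [] \<or> hd w \<noteq> hd w' \<Longrightarrow> P w w'"
  shows "P w w'"
proof (induction w arbitrary: w')
  case (Cons z w)
  show ?case
  proof (cases "w' \<noteq> [] \<and> hd w' = z")
    case True
    then obtain r where "w' = z # r" by (cases w') auto
    then show ?thesis using assms(1) Cons by blast
  qed (auto intro: assms(2))
qed (simp add: assms(2))

lemma dist_sheets_nonneg [simp]: "0 \<le> dist_sheets p q"
proof -
  have "0 \<le> dist_sheets (w, u) (w', v)" for w u w' v
    by (induction w w' rule: dist_sheets_induct) (auto simp: dist_sheets_diverge)
  then show ?thesis by (metis prod.collapse)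
qed

lemma dist_sheets_commute: "dist_sheets p q = dist_sheets q p"
proof -
  have "dist_sheets (w, u) (w', v) = dist_sheets (w', v) (w, u)" for w u w' v
  proof (induction w w' rule: dist_sheets_induct)
    case (diverge w w')
    then have "w' = [] \<or> w = [] \<or> hd w' \<noteq> hd w" by metis
    then show ?case
      using diverge dist_same_word_commute[of "first w u"] by (simp add: dist_sheets_diverge)
  qed simp
  then show ?thesis by (metis prod.collapse)
qed

lemma dist_sheets_same_word [simp]: "dist_sheets (w, u) (w, v) = dist_same_word u v"
  by (induction w) (auto simp: dist_sheets_diverge)

lemma dist_sheets_self: "p \<in> sheet_points \<Longrightarrow> dist_sheets p p = 0"
  by (auto simp: sheet_points_def)

text \<open>Letters alternate, so the sheet behind the letter \<open>z\<close> belongs to the other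
  factor. It is entered at its base point, which is why distances measured from there are values of
  \<open>nrm\<close>.\<close>

lemma isl_first_after:
  assumes "(w @ z # s, v) \<in> sheet_points"
  shows "isl (first s v) \<noteq> isl z"
  using assms
  by (cases s) (auto simp: sheet_points_def words_X_def words_Y_def normal_words_def
      successively_append_iff)

lemma dist_sheets_cut_word:
  assumes "\<not> prefix (w @ [z]) w'"
  shows "dist_sheets (w', u) (w @ z # s, v) = dist_sheets (w', u) (w, index z) + height (z # s) v"
  using assms
proof (induction w arbitrary: w')
  case Nil
  then have "w' = [] \<or> hd w' \<noteq> z" by (cases w') auto
  then show ?case by (auto simp: dist_sheets_diverge)
next
  case (Cons a w)
  show ?case
  proof (cases "w' \<noteq> [] \<and> hd w' = a")
    case True
    then obtain r where "w' = a # r" by (cases w') auto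
    then show ?thesis using Cons by simp
  next
    case False
    then have "w' = [] \<or> hd w' \<noteq> a" by blast
    then show ?thesis
      using height_append[of "a # w" z s v] by (simp add: dist_sheets_diverge del: height.simps)
  qed
qed

text \<open>The edge \<open>e\<close> separates the free product; \<open>beyond e\<close> is the side of \<open>edge_end e\<close>.\<close>

fun beyond :: "('i, 'j) edge \<Rightarrow> ('i, 'j) word \<times> ('a + 'b) \<Rightarrow> bool" where
  "beyond Base_edge (w, u) \<longleftrightarrow> \<not> isl (first w u)"
| "beyond (Edge w' z) (w, u) \<longleftrightarrow> prefix (w' @ [z]) w"

lemma beyond_edge_start: "\<not> beyond e (edge_start e)"
  by (cases e) (auto dest: prefix_length_le)

lemma beyond_edge_end: "beyond e (edge_end e)"
  by (cases e) auto

text \<open>Every other edge lies on one side of \<open>e\<close> as a whole, so either of its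
  endpoints may decide which side.\<close>

lemma beyond_start_end: "e \<noteq> e' \<Longrightarrow> beyond e (edge_start e') \<longleftrightarrow> beyond e (edge_end e')"
  by (cases e; cases e') (auto simp: first_append[of _ _ "[]"])

lemma edge_start_sheet: "e \<in> edges \<Longrightarrow> edge_start e \<in> sheet_points"
  using iX iY eX by (auto simp: edges_def sheet_points_def words_X_def normal_words_def)

lemma edge_end_sheet: "e \<in> edges \<Longrightarrow> edge_end e \<in> sheet_points"
  using eX eY by (auto simp: edges_def sheet_points_def words_X_def words_Y_def normal_words_def
      successively_append_iff)

text \<open>The tree structure of the free product in metric form: any route from one side of
  \<open>e\<close> to the other runs through all of \<open>e\<close>. The additivity required for
  attaching pieces is derived from this.\<close>

lemma dist_sheets_cut:
  assumes "e \<in> edges" "p \<in> sheet_points" "q \<in> sheet_points" "\<not> beyond e p" "beyond e q"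
  shows "dist_sheets p q = dist_sheets p (edge_start e) + 1 + dist_sheets (edge_end e) q"
proof (cases e)
  case Base_edge
  obtain w u w' v where pq: "p = (w, u)" "q = (w', v)" by (metis prod.collapse)
  \<comment> \<open>On different sides of the base edge the first exit points lie in different
    factors. Hence the words share no first letter, and the mixed clause applies, whose summand 1 is
    the base edge.\<close>
  have "isl (first w u)" "\<not> isl (first w' v)" using assms Base_edge pq by auto
  then obtain x y where "first w u = Inl x" "first w' v = Inr y"
    by (metis isl_def sum.collapse(2))
  moreover from this have "w = [] \<or> w' = [] \<or> hd w \<noteq> hd w'" by (cases w; cases w') auto
  ultimately show ?thesis
    using Base_edge by (simp add: pq dist_sheets_diverge X.commute Y.commute)
next
  case (Edge w z)
  obtain w' u where p: "p = (w', u)" by fastforce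
  obtain s v where q: "q = (w @ z # s, v)"
    using assms Edge by (cases q) (auto simp: prefix_def)
  have "isl (first s v) \<noteq> isl z" using isl_first_after assms q by blast
  then have "dist_same_word (if isl z then Inr eY else Inl eX) (first s v) = nrm (first s v)"
    by (cases "first s v") auto
  moreover have "dist_sheets (w @ [z], b) (w @ z # s, v) = dist_sheets ([], b) (s, v)" for b
    by (induction w) auto
  ultimately have "1 + dist_sheets (edge_end e) q = height (z # s) v"
    using Edge q by (simp add: dist_sheets_diverge)
  then show ?thesis
    using dist_sheets_cut_word[of w z w' u s v] assms Edge p q by simp
qed

section \<open>Distances across an edge, for points on sheets and on edges\<close>

primrec anchor :: "('a, 'b, 'i, 'j) pre_point \<Rightarrow> ('i, 'j) word \<times> ('a + 'b)" where
  "anchor (On_sheet p) = p"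
| "anchor (On_edge e t) = edge_start e"

text \<open>Points of \<open>e\<close> itself are neither before nor after \<open>e\<close>; for a
  point of another edge its starting point decides.\<close>

definition before :: "('i, 'j) edge \<Rightarrow> ('a, 'b, 'i, 'j) pre_point \<Rightarrow> bool" where
  "before e x \<longleftrightarrow> \<not> beyond e (anchor x) \<and> (\<forall>t. x \<noteq> On_edge e t)"

definition after :: "('i, 'j) edge \<Rightarrow> ('a, 'b, 'i, 'j) pre_point \<Rightarrow> bool" where
  "after e x \<longleftrightarrow> beyond e (anchor x) \<and> (\<forall>t. x \<noteq> On_edge e t)"

lemma pre_points_cases [consumes 1, case_names sheet edge]:
  assumes "x \<in> pre_points"
  obtains q where "q \<in> sheet_points" "x = On_sheet q"
    | e t where "e \<in> edges" "0 \<le> t" "t \<le> 1" "x = On_edge e t"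
  using assms by (auto simp: pre_points_def)

lemma On_sheet_pre [simp]: "On_sheet q \<in> pre_points \<longleftrightarrow> q \<in> sheet_points"
  and On_edge_pre [simp]: "On_edge e t \<in> pre_points \<longleftrightarrow> e \<in> edges \<and> 0 \<le> t \<and> t \<le> 1"
  by (auto simp: pre_points_def)

lemma pre_dist_nonneg: "x \<in> pre_points \<Longrightarrow> y \<in> pre_points \<Longrightarrow> 0 \<le> pre_dist x y"
  by (erule pre_points_cases; erule pre_points_cases) (auto simp: dist_edge_sheet_def)

lemma pre_dist_commute: "pre_dist x y = pre_dist y x"
proof (cases x; cases y)
  fix e t e' t' assume "x = On_edge e t" "y = On_edge e' t'"
  then show ?thesis
    using dist_sheets_commute[of "edge_start e" "edge_start e'"]
      dist_sheets_commute[of "edge_end e" "edge_start e'"]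
      dist_sheets_commute[of "edge_start e" "edge_end e'"]
      dist_sheets_commute[of "edge_end e" "edge_end e'"]
    by (auto simp: dist_edge_sheet_def)
qed (auto simp: dist_sheets_commute)

lemma pre_dist_edge:
  assumes "\<And>s. x \<noteq> On_edge e s"
  shows "pre_dist (On_edge e t) x =
    min (t + pre_dist (On_sheet (edge_start e)) x) (1 - t + pre_dist (On_sheet (edge_end e)) x)"
  using assms by (cases x) (auto simp: dist_edge_sheet_def)

lemma pre_dist_On_sheet_On_edge:
  "pre_dist (On_sheet p) (On_edge e t) =
    min (t + dist_sheets (edge_start e) p) (1 - t + dist_sheets (edge_end e) p)"
  by (simp add: dist_edge_sheet_def)

lemma pre_dist_before_after:
  assumes e: "e \<in> edges" and x: "x \<in> pre_points" "before e x"
    and q: "q \<in> sheet_points" "beyond e q"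
  shows "pre_dist (On_sheet q) x =
    pre_dist (On_sheet (edge_start e)) x + 1 + dist_sheets (edge_end e) q"
  using x(1)
proof (cases x rule: pre_points_cases)
  case (sheet p)
  then show ?thesis
    using dist_sheets_cut[OF e, of p q] x q by (simp add: before_def dist_sheets_commute)
next
  case (edge e' t)
  then have "\<not> beyond e (edge_start e')" "\<not> beyond e (edge_end e')"
    using x beyond_start_end[of e e'] by (auto simp: before_def)
  then show ?thesis
    using dist_sheets_cut[OF e _ q(1) _ q(2)] edge edge_start_sheet edge_end_sheet
    by (auto simp: pre_dist_On_sheet_On_edge simp del: pre_dist.simps)
qed

lemma pre_dist_after_before:
  assumes e: "e \<in> edges" and x: "x \<in> pre_points" "after e x"
  shows "pre_dist (On_sheet (edge_start e)) x = pre_dist (On_sheet (edge_end e)) x + 1"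
  using x(1)
proof (cases x rule: pre_points_cases)
  case (sheet p)
  then show ?thesis
    using dist_sheets_cut[OF e edge_start_sheet[OF e], of p] beyond_edge_start[of e] x
      dist_sheets_self[OF edge_start_sheet[OF e]] by (simp add: after_def)
next
  case (edge e' t)
  then have *: "beyond e (edge_start e')" "beyond e (edge_end e')"
    using x beyond_start_end[of e e'] by (auto simp: after_def)
  have "dist_sheets q (edge_start e) = dist_sheets q (edge_end e) + 1"
    if "q \<in> sheet_points" "beyond e q" for q
    using dist_sheets_cut[OF e edge_start_sheet[OF e] that(1) beyond_edge_start that(2)]
      dist_sheets_self[OF edge_start_sheet[OF e]] by (simp add: dist_sheets_commute)
  then show ?thesis
    using * edge edge_start_sheet edge_end_sheet
    by (auto simp: pre_dist_On_sheet_On_edge simp del: pre_dist.simps)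
qed

lemma pre_dist_end_before:
  assumes e: "e \<in> edges" and x: "x \<in> pre_points" "before e x"
  shows "pre_dist (On_sheet (edge_end e)) x = pre_dist (On_sheet (edge_start e)) x + 1"
  using pre_dist_before_after[OF assms edge_end_sheet[OF e] beyond_edge_end]
    dist_sheets_self[OF edge_end_sheet[OF e]] by simp

text \<open>For a point off the edge, only one of the two terms of the minimum is attained,
  depending on its side.\<close>

lemma pre_dist_edge_before:
  assumes "e \<in> edges" "x \<in> pre_points" "before e x" "t \<le> 1"
  shows "pre_dist (On_edge e t) x = t + pre_dist (On_sheet (edge_start e)) x"
  using assms pre_dist_end_before[OF assms(1-3)] pre_dist_edge[of x e t] by (simp add: before_def)

lemma pre_dist_edge_after:
  assumes "e \<in> edges" "x \<in> pre_points" "after e x" "0 \<le> t"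
  shows "pre_dist (On_edge e t) x = 1 - t + pre_dist (On_sheet (edge_end e)) x"
  using assms pre_dist_after_before[OF assms(1-3)] pre_dist_edge[of x e t] by (simp add: after_def)

lemma before_edge_start: "before e (On_sheet (edge_start e))"
  and after_edge_end: "after e (On_sheet (edge_end e))"
  by (auto simp: before_def after_def beyond_edge_start beyond_edge_end)

lemma pre_dist_edge_start:
  "\<lbrakk>e \<in> edges; t \<le> 1\<rbrakk> \<Longrightarrow> pre_dist (On_edge e t) (On_sheet (edge_start e)) = t"
  using pre_dist_edge_before[of e "On_sheet (edge_start e)" t]
  by (simp add: before_edge_start edge_start_sheet dist_sheets_self del: pre_dist.simps(2))

lemma pre_dist_edge_end:
  "\<lbrakk>e \<in> edges; 0 \<le> t\<rbrakk> \<Longrightarrow> pre_dist (On_edge e t) (On_sheet (edge_end e)) = 1 - t"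
  using pre_dist_edge_after[of e "On_sheet (edge_end e)" t]
  by (simp add: after_edge_end edge_end_sheet dist_sheets_self del: pre_dist.simps(2))

lemma on_edge_cases:
  obtains "before e x" | "after e x" | t where "x = On_edge e t"
  unfolding before_def after_def by blast

text \<open>At parameters 0 and 1 the attained term is the distance to the glued endpoint, or
  exceeds by the edge length the distance to the nearer one, which is again the distance to the
  glued endpoint.\<close>

lemma pre_dist_glue:
  assumes "(x, x') \<in> glue" "y \<in> pre_points"
  shows "pre_dist x y = pre_dist x' y"
proof -
  from assms(1) obtain e where e: "e \<in> edges"
    and x: "x = On_sheet (edge_start e) \<and> x' = On_edge e 0 \<or> x = On_sheet (edge_end e) \<and> x' = On_edge e 1"
    by (auto simp: glue_def)
  show ?thesis
  proof (cases e y rule: on_edge_cases)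
    case 1
    then show ?thesis
      using x pre_dist_edge_before[OF e assms(2)] pre_dist_end_before[OF e assms(2)] by auto
  next
    case 2
    then show ?thesis
      using x pre_dist_edge_after[OF e assms(2)] pre_dist_after_before[OF e assms(2)] by auto
  next
    case (3 t)
    then have "0 \<le> t" "t \<le> 1" using assms(2) by auto
    then have "pre_dist (On_sheet (edge_start e)) y = t" "pre_dist (On_sheet (edge_end e)) y = 1 - t"
      using pre_dist_edge_start[OF e, of t] pre_dist_edge_end[OF e, of t] pre_dist_commute 3
      by metis+
    then show ?thesis using x 3 \<open>0 \<le> t\<close> \<open>t \<le> 1\<close> by auto
  qed
qed

section \<open>Passage to the quotient\<close>

lemma glue_pre_points: "(x, x') \<in> glue \<Longrightarrow> x \<in> pre_points \<and> x' \<in> pre_points"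
  by (auto simp: glue_def edge_start_sheet edge_end_sheet)

definition cls :: "('a, 'b, 'i, 'j) pre_point \<Rightarrow> ('a, 'b, 'i, 'j) pre_point set" where
  "cls x = (glue \<union> glue\<inverse>)\<^sup>* `` {x}"

lemma points_eq: "points = cls ` pre_points"
  by (auto simp: points_def quotient_def cls_def)

lemma cls_glue: "(x, x') \<in> glue \<Longrightarrow> cls x = cls x'"
proof -
  assume "(x, x') \<in> glue"
  then have "(x, x') \<in> (glue \<union> glue\<inverse>)\<^sup>*" by blast
  moreover have "equiv UNIV ((glue \<union> glue\<inverse>)\<^sup>*)"
    by (intro equivI refl_rtrancl trans_rtrancl sym_rtrancl sym_Un_converse) auto
  ultimately show ?thesis unfolding cls_def by (metis equiv_class_eq)
qed

lemma pre_dist_cls: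
  assumes "x \<in> pre_points" "x' \<in> cls x" "y \<in> pre_points"
  shows "x' \<in> pre_points \<and> pre_dist x' y = pre_dist x y"
proof -
  have "(x, x') \<in> (glue \<union> glue\<inverse>)\<^sup>*" using assms by (simp add: cls_def)
  then show ?thesis
  proof (induction rule: rtrancl_induct)
    case (step u v)
    then show ?case using pre_dist_glue[OF _ assms(3)] glue_pre_points by fastforce
  qed (simp add: assms)
qed

lemma dist_star_cls:
  assumes "x \<in> pre_points" "y \<in> pre_points"
  shows "dist_star (cls x) (cls y) = pre_dist x y"
proof -
  have "pre_dist x' y' = pre_dist x y" if "x' \<in> cls x" "y' \<in> cls y" for x' y'
  proof -
    have "y' \<in> pre_points" "pre_dist y' x = pre_dist y x"
      using pre_dist_cls[OF assms(2) that(2) assms(1)] by auto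
    then have "pre_dist x' y' = pre_dist x y'"
      using pre_dist_cls[OF assms(1) that(1)] by blast
    also have "\<dots> = pre_dist y' x" by (rule pre_dist_commute)
    also have "\<dots> = pre_dist y x" by fact
    also have "\<dots> = pre_dist x y" by (rule pre_dist_commute)
    finally show ?thesis .
  qed
  then have "(\<lambda>(p, q). pre_dist p q) ` (cls x \<times> cls y) = (\<lambda>_. pre_dist x y) ` (cls x \<times> cls y)"
    by (intro image_cong) auto
  moreover have "(x, y) \<in> cls x \<times> cls y" by (auto simp: cls_def)
  ultimately have "(\<lambda>(p, q). pre_dist p q) ` (cls x \<times> cls y) = {pre_dist x y}" by blast
  then show ?thesis using assms by (simp add: dist_star_def points_eq)
qed

lemma dist_star_nonneg: "0 \<le> dist_star P Q"
proof (cases "P \<in> points \<and> Q \<in> points")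
  case True
  then show ?thesis by (auto simp: points_eq dist_star_cls pre_dist_nonneg)
qed (auto simp: dist_star_def)

lemma dist_star_commute: "dist_star P Q = dist_star Q P"
proof (cases "P \<in> points \<and> Q \<in> points")
  case True
  then show ?thesis using pre_dist_commute by (auto simp: points_eq dist_star_cls)
qed (auto simp: dist_star_def)

section \<open>Exhaustion of the free product by stages\<close>

definition edge_pts :: "('i, 'j) edge \<Rightarrow> ('a, 'b, 'i, 'j) pre_point set set" where
  "edge_pts e = (\<lambda>t. cls (On_edge e t)) ` {0..1}"

text \<open>The word alone does not determine the sheet: over the empty word there is one for each
  factor.\<close>

definition sheet_at :: "('i, 'j) word \<times> ('a + 'b) \<Rightarrow> (('i, 'j) word \<times> ('a + 'b)) set" where
  "sheet_at p = {q \<in> sheet_points. fst q = fst p \<and> isl (snd q) = isl (snd p)}"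

definition sheet_pts ::
    "('i, 'j) word \<times> ('a + 'b) \<Rightarrow> ('a, 'b, 'i, 'j) pre_point set set" where
  "sheet_pts p = (\<lambda>q. cls (On_sheet q)) ` sheet_at p"

text \<open>The shift by one makes room for the base edge: its far sheet, the copy of
  \<open>Y\<close> over the empty word, must be present before edges starting there are
  attached.\<close>

primrec level :: "('i, 'j) edge \<Rightarrow> nat" where
  "level Base_edge = 0"
| "level (Edge w z) = Suc (length w)"

definition stage :: "nat \<Rightarrow> ('a, 'b, 'i, 'j) pre_point set set" where
  "stage k = sheet_pts ([], Inl eX) \<union>
     (\<Union>e\<in>{e \<in> edges. level e < k}. edge_pts e \<union> sheet_pts (edge_end e))"

lemma in_sheet_at: "p \<in> sheet_points \<Longrightarrow> p \<in> sheet_at p"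
  by (simp add: sheet_at_def)

lemma edge_start_pts: "e \<in> edges \<Longrightarrow> cls (On_sheet (edge_start e)) \<in> edge_pts e"
  and edge_end_pts: "e \<in> edges \<Longrightarrow> cls (On_sheet (edge_end e)) \<in> edge_pts e"
  using cls_glue[of "On_sheet (edge_start e)" "On_edge e 0"]
    cls_glue[of "On_sheet (edge_end e)" "On_edge e 1"]
  by (auto simp: glue_def edge_pts_def)

lemma beyond_sheet_at: "q \<in> sheet_at p \<Longrightarrow> beyond e q \<longleftrightarrow> beyond e p"
  by (cases e; cases q; cases p; cases "fst p") (auto simp: sheet_at_def)

text \<open>A longer word cannot be a prefix of a shorter one, so edges behind \<open>e\<close> have
  strictly larger level.\<close>

lemma not_beyond_level:
  assumes "e \<in> edges" "e' \<noteq> e" "level e' \<le> level e"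
  shows "\<not> beyond e (edge_start e')"
  using assms by (cases e; cases e') (auto dest: prefix_length_le)

lemma before_edge:
  assumes "e \<in> edges" "e' \<noteq> e" "level e' \<le> level e"
  shows "before e (On_edge e' t)"
  using not_beyond_level[OF assms] assms(2) by (simp add: before_def)

lemma before_sheet:
  assumes "e \<in> edges" "e' \<noteq> e" "level e' \<le> level e" "q \<in> sheet_at (edge_end e')"
  shows "before e (On_sheet q)"
  using not_beyond_level[OF assms(1-3)] beyond_start_end[of e e'] beyond_sheet_at[OF assms(4)] assms(2)
  by (simp add: before_def)

text \<open>All that is built before \<open>e\<close> is attached lies on its near side, so the cut
  formulas apply to it.\<close>

lemma stage_before:
  assumes "e \<in> edges" "k \<le> level e" "P \<in> stage k"
  obtains x where "x \<in> pre_points" "P = cls x" "before e x"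
proof -
  consider q where "q \<in> sheet_at ([], Inl eX)" "P = cls (On_sheet q)"
    | e' t where "e' \<in> edges" "level e' < k" "0 \<le> t" "t \<le> 1" "P = cls (On_edge e' t)"
    | e' q where "e' \<in> edges" "level e' < k" "q \<in> sheet_at (edge_end e')" "P = cls (On_sheet q)"
    using assms(3) by (auto simp: stage_def edge_pts_def sheet_pts_def)
  then show ?thesis
  proof cases
    case 1
    moreover have "\<not> beyond e ([], Inl eX)" by (cases e) auto
    ultimately have "before e (On_sheet q)" using beyond_sheet_at[of q _ e] by (auto simp: before_def)
    moreover have "q \<in> sheet_points" using 1 by (simp add: sheet_at_def)
    ultimately show ?thesis using that[of "On_sheet q"] 1 by simp
  next
    case 2
    then show ?thesis using that[of "On_edge e' t"] before_edge[of e e' t] assms(1,2) by fastforce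
  next
    case 3
    moreover have "q \<in> sheet_points" using 3 by (simp add: sheet_at_def)
    ultimately show ?thesis
      using that[of "On_sheet q"] before_sheet[of e e' q] assms(1,2) by fastforce
  qed
qed

text \<open>The last letter of the word names the edge leading to the sheet. Over the empty word,
  the copy of \<open>Y\<close> is reached by the base edge, and the copy of \<open>X\<close> is the
  root.\<close>

lemma sheet_in_stage:
  assumes "q \<in> sheet_points"
  shows "cls (On_sheet q) \<in> stage (Suc (length (fst q)))"
proof (cases "fst q" rule: rev_cases)
  case Nil
  show ?thesis
  proof (cases "isl (snd q)")
    case True
    then have "q \<in> sheet_at ([], Inl eX)" using assms Nil by (simp add: sheet_at_def)
    then show ?thesis by (auto simp: stage_def sheet_pts_def)
  next
    case False
    then have "q \<in> sheet_at (edge_end Base_edge)" using assms Nil by (simp add: sheet_at_def)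
    moreover have "Base_edge \<in> edges" by (simp add: edges_def)
    ultimately show ?thesis unfolding stage_def sheet_pts_def by fastforce
  qed
next
  case (snoc w z)
  have "Edge w z \<in> edges"
    using assms snoc
    by (cases z; cases "w = []") (auto simp: edges_def sheet_points_def words_X_def words_Y_def
        normal_words_def successively_append_iff)
  moreover have "q \<in> sheet_at (edge_end (Edge w z))"
    using assms snoc isl_first_after[of w z "[]" "snd q"]
    by (cases z; cases q) (auto simp: sheet_at_def)
  moreover have "level (Edge w z) < Suc (length (fst q))" using snoc by simp
  ultimately show ?thesis unfolding stage_def sheet_pts_def by blast
qed

lemma edge_start_stage:
  assumes "e \<in> edges"
  shows "cls (On_sheet (edge_start e)) \<in> stage (level e)"
proof (cases e)
  case Base_edge
  then show ?thesis
    using in_sheet_at[OF edge_start_sheet[OF assms]] by (auto simp: stage_def sheet_pts_def)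
next
  case (Edge w z)
  then show ?thesis using sheet_in_stage[OF edge_start_sheet[OF assms]] by simp
qed

lemma Union_stage: "(\<Union>k. stage k) = points"
proof
  have "sheet_pts p \<subseteq> points" for p
    by (auto simp: sheet_pts_def sheet_at_def points_eq)
  moreover have "edge_pts e \<subseteq> points" if "e \<in> edges" for e
    using that by (auto simp: edge_pts_def points_eq)
  ultimately show "(\<Union>k. stage k) \<subseteq> points" unfolding stage_def by blast
  show "points \<subseteq> (\<Union>k. stage k)"
  proof
    fix P assume "P \<in> points"
    then obtain x where x: "x \<in> pre_points" "P = cls x" by (auto simp: points_eq)
    from x(1) show "P \<in> (\<Union>k. stage k)"
    proof (cases rule: pre_points_cases)
      case (sheet q)
      then show ?thesis using sheet_in_stage[of q] x by blast
    next
      case (edge e t)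
      then have "P \<in> edge_pts e" using x by (auto simp: edge_pts_def)
      then have "P \<in> stage (Suc (level e))" using edge by (auto simp: stage_def)
      then show ?thesis by blast
    qed
  qed
qed

lemma tripod_bicombing_edge:
  assumes "e \<in> edges" "1 \<le> E" "0 \<le> C"
  shows "\<exists>G. tripod_bicombing (edge_pts e) dist_star G E C"
proof -
  have "tripod_bicombing {0..1::real} dist (\<lambda>x y t. if x \<le> y then x + t else x - t) E C"
    using tripod_bicombing.weaken[OF tripod_bicombing_unit_interval assms(2,3)] .
  then show ?thesis
    unfolding edge_pts_def
    by (intro exI) (erule tripod_bicombing_image,
        use assms dist_star_nonneg dist_star_commute in \<open>auto simp: dist_star_cls dist_real_def\<close>)
qed

lemma tripod_bicombing_sheet:
  assumes p: "p \<in> sheet_points"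
    and GX: "tripod_bicombing X dX GX E C" and GY: "tripod_bicombing Y dY GY E C"
  shows "\<exists>G. tripod_bicombing (sheet_pts p) dist_star G E C"
proof -
  obtain w u where wu: "p = (w, u)" by fastforce
  show ?thesis
  proof (cases u)
    case (Inl x)
    then have "sheet_at p = (\<lambda>x. (w, Inl x)) ` X"
      using p wu by (auto simp: sheet_at_def sheet_points_def)
    then have "sheet_pts p = (\<lambda>x. cls (On_sheet (w, Inl x))) ` X"
      by (simp add: sheet_pts_def image_image)
    moreover have "(w, Inl x) \<in> sheet_points" if "x \<in> X" for x
      using p wu Inl that by (auto simp: sheet_points_def)
    ultimately show ?thesis
      using tripod_bicombing_image[OF GX, of dist_star "\<lambda>x. cls (On_sheet (w, Inl x))"]
        dist_star_nonneg dist_star_commute by (auto simp: dist_star_cls)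
  next
    case (Inr y)
    then have "sheet_at p = (\<lambda>y. (w, Inr y)) ` Y"
      using p wu by (auto simp: sheet_at_def sheet_points_def)
    then have "sheet_pts p = (\<lambda>y. cls (On_sheet (w, Inr y))) ` Y"
      by (simp add: sheet_pts_def image_image)
    moreover have "(w, Inr y) \<in> sheet_points" if "y \<in> Y" for y
      using p wu Inr that by (auto simp: sheet_points_def)
    ultimately show ?thesis
      using tripod_bicombing_image[OF GY, of dist_star "\<lambda>y. cls (On_sheet (w, Inr y))"]
        dist_star_nonneg dist_star_commute by (auto simp: dist_star_cls)
  qed
qed

section \<open>Attaching one level of edges and sheets\<close>

lemma dist_star_before_edge:
  assumes "e \<in> edges" "x \<in> pre_points" "before e x" "0 \<le> t" "t \<le> 1"
  shows "dist_star (cls x) (cls (On_edge e t)) =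
    dist_star (cls x) (cls (On_sheet (edge_start e))) +
    dist_star (cls (On_sheet (edge_start e))) (cls (On_edge e t))"
  using pre_dist_edge_before[of e x t] pre_dist_edge_start[of e t] assms
  by (simp add: dist_star_cls edge_start_sheet pre_dist_commute[of x]
      pre_dist_commute[of "On_sheet _" "On_edge _ _"] del: pre_dist.simps)

lemma dist_star_before_sheet:
  assumes "e \<in> edges" "x \<in> pre_points" "before e x" "q \<in> sheet_at (edge_end e)"
  shows "dist_star (cls x) (cls (On_sheet q)) =
    dist_star (cls x) (cls (On_sheet (edge_end e))) +
    dist_star (cls (On_sheet (edge_end e))) (cls (On_sheet q))"
proof -
  have "q \<in> sheet_points" "beyond e q"
    using assms(4) beyond_sheet_at[OF assms(4)] beyond_edge_end by (auto simp: sheet_at_def)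
  then show ?thesis
    using pre_dist_before_after[OF assms(1-3)] pre_dist_end_before[OF assms(1-3)] assms(1,2)
    by (simp add: dist_star_cls edge_end_sheet pre_dist_commute[of x])
qed

lemma dist_star_edge_sheet:
  assumes "e \<in> edges" "0 \<le> t" "t \<le> 1" "q \<in> sheet_at (edge_end e)"
  shows "dist_star (cls (On_edge e t)) (cls (On_sheet q)) =
    dist_star (cls (On_edge e t)) (cls (On_sheet (edge_end e))) +
    dist_star (cls (On_sheet (edge_end e))) (cls (On_sheet q))"
proof -
  have "q \<in> sheet_points" "beyond e q"
    using assms(4) beyond_sheet_at[OF assms(4)] beyond_edge_end by (auto simp: sheet_at_def)
  then show ?thesis
    using pre_dist_edge_after[of e "On_sheet q" t] pre_dist_edge_end[of e t] assms
    by (simp add: dist_star_cls edge_end_sheet after_def del: pre_dist.simps)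
qed

text \<open>A stage consists of two wedges: edges of level \<open>k\<close> attached at their
  starts, and sheets attached at the far ends of these edges.\<close>

lemma ex_stage_step:
  assumes G: "tripod_bicombing (stage k) dist_star G E C"
    and GX: "tripod_bicombing X dX GX E C" and GY: "tripod_bicombing Y dY GY E C"
  shows "\<exists>G'. tripod_bicombing (stage (Suc k)) dist_star G' E C \<and>
    (\<forall>P\<in>stage k. \<forall>Q\<in>stage k. \<forall>t\<in>{0..dist_star P Q}. G' P Q t = G P Q t)"
proof -
  let ?I = "{e \<in> edges. level e = k}"
  let ?s = "\<lambda>e. cls (On_sheet (edge_start e))" and ?t = "\<lambda>e. cls (On_sheet (edge_end e))"
  interpret G: tripod_bicombing "stage k" dist_star G E C by (rule G)
  have "\<forall>e\<in>?I. \<exists>H. tripod_bicombing (edge_pts e) dist_star H E C"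
    using tripod_bicombing_edge G.E_ge_1 G.C_nonneg by blast
  from bchoice[OF this]
  obtain H where H: "\<forall>e\<in>?I. tripod_bicombing (edge_pts e) dist_star (H e) E C" ..
  have "\<forall>e\<in>?I. \<exists>H. tripod_bicombing (sheet_pts (edge_end e)) dist_star H E C"
    using tripod_bicombing_sheet[OF edge_end_sheet GX GY] by blast
  from bchoice[OF this]
  obtain K where K: "\<forall>e\<in>?I. tripod_bicombing (sheet_pts (edge_end e)) dist_star (K e) E C" ..
  have stage_edge: "dist_star P Q = dist_star P (?s e) + dist_star (?s e) Q"
    if "e \<in> ?I" "P \<in> stage k" "Q \<in> edge_pts e" for e P Q
  proof -
    obtain x where "x \<in> pre_points" "P = cls x" "before e x"
      using stage_before[of e k P] \<open>e \<in> ?I\<close> \<open>P \<in> stage k\<close> by auto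
    then show ?thesis using that dist_star_before_edge[of e x] by (auto simp: edge_pts_def)
  qed
  have edge_edge: "dist_star P Q = dist_star P (?s e) + dist_star (?s e) Q"
    if "e \<in> ?I" "e' \<in> ?I" "e' \<noteq> e" "P \<in> edge_pts e'" "Q \<in> edge_pts e" for e e' P Q
    using that dist_star_before_edge[of e "On_edge e' _"] before_edge[of e e']
    by (auto simp: edge_pts_def)
  interpret W1: wedge "stage k" dist_star G E C ?I edge_pts ?s H
  proof (intro wedge.intro G wedge_axioms.intro)
    show "?s e \<in> stage k" "?s e \<in> edge_pts e" if "e \<in> ?I" for e
      using that edge_start_stage edge_start_pts by auto
    show "dist_star P Q = dist_star P (?s e) + dist_star (?s e) (?s e') + dist_star (?s e') Q"
      if e: "e \<in> ?I" "e' \<in> ?I" "e \<noteq> e'" "P \<in> edge_pts e" "Q \<in> edge_pts e'" for e e' P Q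
    proof -
      \<comment> \<open>For two new edges, splitting at the second attachment point reduces the
        formula to the distance from an old point to the first edge.\<close>
      have "?s e' \<in> stage k" using e edge_start_stage[of e'] by simp
      then have "dist_star (?s e') P = dist_star (?s e') (?s e) + dist_star (?s e) P"
        using stage_edge e(1,4) by blast
      then have "dist_star P (?s e') = dist_star P (?s e) + dist_star (?s e) (?s e')"
        by (simp add: dist_star_commute)
      then show ?thesis using edge_edge[of e' e P Q] e by simp
    qed
  qed (use H stage_edge in auto)
  have W1_W: "W1.W = stage k \<union> (\<Union>e\<in>?I. edge_pts e)" by (simp add: W1.W_def)
  have before_sheet': "dist_star P Q = dist_star P (?t e) + dist_star (?t e) Q"
    if "e \<in> ?I" "x \<in> pre_points" "before e x" "P = cls x" "Q \<in> sheet_pts (edge_end e)" for e x P Q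
    using that dist_star_before_sheet[of e x] by (auto simp: sheet_pts_def)
  have W1_sheet: "dist_star P Q = dist_star P (?t e) + dist_star (?t e) Q"
    if e: "e \<in> ?I" "P \<in> W1.W" "Q \<in> sheet_pts (edge_end e)" for e P Q
  proof -
    consider "P \<in> stage k" | e' t where "e' \<in> ?I" "P = cls (On_edge e' t)" "0 \<le> t" "t \<le> 1"
      using e(2) by (auto simp: W1_W edge_pts_def)
    then show ?thesis
    proof cases
      case 1
      then obtain x where "x \<in> pre_points" "P = cls x" "before e x"
        using stage_before[of e k P] e by auto
      then show ?thesis using before_sheet' e by blast
    next
      case (2 e' t)
      show ?thesis
      proof (cases "e' = e")
        case True
        then show ?thesis using 2 e dist_star_edge_sheet[of e t] by (auto simp: sheet_pts_def)
      next
        case False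
        then show ?thesis
          using 2 e before_edge[of e e' t] before_sheet'[of e "On_edge e' t"] by auto
      qed
    qed
  qed
  interpret W2: wedge W1.W dist_star W1.geo E C ?I "\<lambda>e. sheet_pts (edge_end e)" ?t K
  proof (intro wedge.intro W1.tripod_bicombing_W wedge_axioms.intro)
    show "?t e \<in> W1.W" "?t e \<in> sheet_pts (edge_end e)" if "e \<in> ?I" for e
      using that edge_end_pts in_sheet_at[OF edge_end_sheet] by (auto simp: W1_W sheet_pts_def)
    then show "dist_star P Q = dist_star P (?t e) + dist_star (?t e) (?t e') + dist_star (?t e') Q"
      if e: "e \<in> ?I" "e' \<in> ?I" "e \<noteq> e'" "P \<in> sheet_pts (edge_end e)"
        "Q \<in> sheet_pts (edge_end e')" for e e' P Q
    proof -
      obtain q where "q \<in> sheet_at (edge_end e)" "P = cls (On_sheet q)"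
        using e(4) by (auto simp: sheet_pts_def)
      moreover from this have "q \<in> sheet_points" by (simp add: sheet_at_def)
      ultimately have "dist_star P Q = dist_star P (?t e') + dist_star (?t e') Q"
        using before_sheet'[of e' "On_sheet q"] before_sheet[of e' e q] e by auto
      \<comment> \<open>The remaining distance starts at a point of the first wedge, so it splits
        again at the far end of \<open>e\<close>.\<close>
      moreover have "dist_star (?t e') P = dist_star (?t e') (?t e) + dist_star (?t e) P"
        using W1_sheet[OF e(1) _ e(4), of "?t e'"] e(2) edge_end_pts by (auto simp: W1_W)
      ultimately show ?thesis by (simp add: dist_star_commute)
    qed
  qed (use K W1_sheet in auto)
  have "W2.W = stage k \<union> (\<Union>e\<in>?I. edge_pts e) \<union> (\<Union>e\<in>?I. sheet_pts (edge_end e))"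
    by (subst W2.W_def) (simp only: W1_W)
  also have "\<dots> = stage (Suc k)"
    by (auto simp: stage_def less_Suc_eq)
  finally have "W2.W = stage (Suc k)" .
  then have "tripod_bicombing (stage (Suc k)) dist_star W2.geo E C"
    using W2.tripod_bicombing_W by simp
  moreover have "W2.geo P Q t = G P Q t"
    if "P \<in> stage k" "Q \<in> stage k" "t \<in> {0..dist_star P Q}" for P Q t
    using W2.geo_A[of P Q t] W1.geo_A[of P Q t] that by (simp add: W1_W)
  ultimately show ?thesis by blast
qed

lemma ex_tripod_bicombing_points:
  assumes GX: "tripod_bicombing X dX GX E C" and GY: "tripod_bicombing Y dY GY E C"
  shows "\<exists>G. tripod_bicombing points dist_star G E C"
proof -
  have "stage 0 = sheet_pts ([], Inl eX)" by (simp add: stage_def)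
  moreover have "([], Inl eX) \<in> sheet_points"
    using eX by (auto simp: sheet_points_def words_X_def normal_words_def)
  ultimately obtain G where "tripod_bicombing (stage 0) dist_star G E C"
    using tripod_bicombing_sheet[OF _ GX GY] by metis
  moreover have "stage k \<subseteq> stage (Suc k)" for k by (force simp: stage_def)
  ultimately show ?thesis
    using tripod_bicombing_Union[of stage dist_star G E C] ex_stage_step[OF _ GX GY] Union_stage
    by metis
qed

end

theorem theorem0p1:
  fixes X :: "'a set" and dX :: "'a \<Rightarrow> 'a \<Rightarrow> real"
    and X0 :: "'i set" and iX :: "'i \<Rightarrow> 'a" and eX :: 'a and epsX :: 'i
    and Y :: "'b set" and dY :: "'b \<Rightarrow> 'b \<Rightarrow> real"
    and Y0 :: "'j set" and iY :: "'j \<Rightarrow> 'b" and eY :: 'b and epsY :: 'j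
  assumes "Metric_space X dX" and "Metric_space Y dY"
    and "net X dX X0 iX eX" and "net Y dY Y0 iY eY"
    and "epsX \<in> X0" and "iX epsX = eX"
    and "epsY \<in> Y0" and "iY epsY = eY"
    and "symmetric_geodesic_coarsely_convex X dX"
    and "symmetric_geodesic_coarsely_convex Y dY"
  shows "symmetric_geodesic_coarsely_convex
           (free_product.points X X0 iX eX epsX Y Y0 iY eY epsY)
           (free_product.dist_star X dX X0 iX eX epsX Y dY Y0 iY eY epsY)"
proof -
  obtain GX E\<^sub>X C\<^sub>X where GX: "tripod_bicombing X dX GX E\<^sub>X C\<^sub>X" using ex_tripod_bicombing assms(9) .
  obtain GY E\<^sub>Y C\<^sub>Y where GY: "tripod_bicombing Y dY GY E\<^sub>Y C\<^sub>Y" using ex_tripod_bicombing assms(10) .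
  interpret free_product_nets X dX X0 iX eX epsX Y dY Y0 iY eY epsY
    using assms(1-8) by (intro free_product_nets.intro free_product_nets_axioms.intro)
      (auto simp: net_def)
  \<comment> \<open>All pieces of a wedge must share their constants, hence the maxima over both
    factors.\<close>
  have "tripod_bicombing X dX GX (max E\<^sub>X E\<^sub>Y) (max C\<^sub>X C\<^sub>Y)"
    "tripod_bicombing Y dY GY (max E\<^sub>X E\<^sub>Y) (max C\<^sub>X C\<^sub>Y)"
    using tripod_bicombing.weaken[OF GX] tripod_bicombing.weaken[OF GY] by auto
  then obtain G where "tripod_bicombing points dist_star G (max E\<^sub>X E\<^sub>Y) (max C\<^sub>X C\<^sub>Y)"
    using ex_tripod_bicombing_points by blast
  then show ?thesis by (rule tripod_bicombing.symmetric_geodesic_coarsely_convex)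
qed

end
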